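(* Consider the system $F_\alpha(x,u^{(s)},\widetilde u^{(s)})=0$, $\alpha=1,\ldots,m$. Every infinitesimal generator of point symmetries (or Lie--Bäcklund operator) $$X=\sum_{i=1}^n\xi^i\frac{\partial}{\partial x^i}+\sum_{\beta=1}^m\eta_\beta\frac{\partial}{\partial u^\beta}+\sum_{\widetilde\beta=1}^{\widetilde m}\widetilde\eta_{\widetilde\beta}\frac{\partial}{\partial\widetilde u^{\widetilde\beta}}$$ of this system provides a conservation law for the system consisting of the equations $F_\alpha=0$ $(\alpha=1,\ldots,m)$ and their adjoint equations $F^\star_\alpha=0$ $(\alpha=1,\ldots,m)$, $\widetilde F^\star_{\widetilde\alpha}=0$ $(\widetilde\alpha=1,\ldots,\widetilde m)$.
   Context: Independent variables: $x=(x^1,\ldots,x^n)$. Dependent variables: $u=(u^1,\ldots,u^m)$ and $\widetilde u=(\widetilde u^1,\ldots,\widetilde u^{\widetilde m})$, functions of $x$. The number of equations $m$ is less than or equal to the number $m+\widetilde m$ of dependent variables ($\widetilde m\ge 0$; empty sums are $0$). $u^{(s)}$ denotes the tuple of the $u^j$ and all their partial derivatives up to order $s$; similarly $\widetilde u^{(s)}$. A differential function is a smooth function of $x$ and finitely many derivatives of the dependent variables; the $F_\alpha$ are differential functions. $D_{x^i}$ is the total derivative with respect to $x^i$, and $\mathrm{div}\,C=\sum_iD_{x^i}C^i$. For a dependent variable $z$, the variational derivative is $\frac{\delta}{\delta z}=\sum_J(-1)^{|J|}D_J\frac{\partial}{\partial z_J}$, where $J=(j_1,\ldots,j_n)$ runs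 over multi-indices, $D_J=D_{x^1}^{j_1}\cdots D_{x^n}^{j_n}$ and $z_J=\partial^{|J|}z/\partial (x^1)^{j_1}\cdots\partial(x^n)^{j_n}$. Adjoint equations: introduce new dependent variables $v=(v^1,\ldots,v^m)$ and $\widetilde v=(\widetilde v^1,\ldots,\widetilde v^{\widetilde m})$, functions of $x$, and set $$F^\star_\alpha=\frac{\delta L}{\delta u^\alpha},\qquad \widetilde F^\star_{\widetilde\alpha}=\frac{\delta L}{\delta\widetilde u^{\widetilde\alpha}},\qquad L=\sum_{\beta=1}^m v^\beta F_\beta+\Big(\sum_{\widetilde\beta=1}^{\widetilde m}\widetilde v^{\widetilde\beta}\Big)\Big(\sum_{\nu=1}^m F_\nu\Big).$$ The adjoint equations are $F^\star_\alpha=0$ for $\alpha=1,\ldots,m$ and $\widetilde F^\star_{\widetilde\alpha}=0$ for $\widetilde\alpha=1,\ldots,\widetilde m$. The equations $F_\alpha=0$ together with their adjoint equations are regarded as the Euler--Lagrange equations of the Lagrangian $L$. Prolongation: for an operator $Z=\sum_i\xi^i\partial_{x^i}+\sum_z\zeta^z\partial_z$ ($z$ running over the dependent variables, coefficients being differential functions), $\mathrm{Pr}\,Z=\sum_i\xi^iD_{x^i}+\sum_z\sum_J D_J(W^z)\frac{\partial}{\partial z_J}$ with $W^z=\zeta^z-\sum_i\xi^i z_{x^i}$. Operators of the system: $X$ (coefficients differential functions of $x,u,\widetilde u$ and derivatives of $u,\widetilde u$) is a Lie--Bäcklund operator admitted by the system $F_\alpha=0$ if $\mathrm{Pr}\,X(F_\nu)=\sum_{\mu=1}^m\mathcal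 D_{\nu\mu}(F_\mu)$, $\nu=1,\ldots,m$, for some differential operators $\mathcal D_{\nu\mu}=\lambda^0_{\nu\mu}+\sum_{k\ge1}\sum_{i_1,\ldots,i_k=1}^n\lambda^{i_1\cdots i_k}_{\nu\mu}D_{x^{i_1}}\cdots D_{x^{i_k}}$ (finite sums, coefficients differential functions). The case of a generator of a point symmetry group is that in which the coefficients of $X$ depend only on $(x,u,\widetilde u)$ and $\mathcal D_{\nu\mu}=\lambda^0_{\nu\mu}$ is a differential function. Extension of $X$ to the adjoint variables: $Y=X+\sum_\beta\eta^\star_\beta\partial_{v^\beta}+\sum_{\widetilde\beta}\widetilde\eta^\star_{\widetilde\beta}\partial_{\widetilde v^{\widetilde\beta}}$, where, for $\beta=1,\ldots,m$ and $w^\alpha=v^\alpha+\sum_{\widetilde\beta}\widetilde v^{\widetilde\beta}$, $$\eta^\star_\beta+\sum_{\widetilde\beta=1}^{\widetilde m}\widetilde\eta^\star_{\widetilde\beta}=-\Big\{w^\beta\sum_{i=1}^nD_{x^i}(\xi^i)+\sum_{\mu=1}^m\Big[w^\mu\lambda^0_{\mu\beta}+\sum_{k\ge1}(-1)^k\sum_{i_1,\ldots,i_k=1}^nD_{x^{i_1}}\cdots D_{x^{i_k}}\big(w^\mu\lambda^{i_1\cdots i_k}_{\mu\beta}\big)\Big]\Big\}.$$ Conservation law: a vector $C=(C^1,\ldots,C^n)$ of differential functions of the dependent variables $u,\widetilde u,v,\widetilde v$ is a conserved vector for the combined system (and provides a conservation law for it) if $\mathrm{div}\,C=0$ for all solutions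 of $F_\alpha=0$, $F^\star_\alpha=0$, $\widetilde F^\star_{\widetilde\alpha}=0$. The conservation law provided by $X$ is the one given by Noether's theorem applied to $Y$ and $L$: $Y$ satisfies the variational infinitesimal invariance criterion $$\mathrm{Pr}\,Y(L)+L\,\mathrm{div}\,\xi=\mathrm{div}\,B$$ for some vector $B=(B^1,\ldots,B^n)$ of differential functions, and the conserved vector $C$ has components $$C^i=-B^i+\xi^iL+\sum_{z}\sum_{k_1=0}^{s^z_1}\cdots\sum_{k_i=0}^{s^z_i-1}\cdots\sum_{k_n=0}^{s^z_n}D_{x^1}^{k_1}\cdots D_{x^n}^{k_n}(W^z)\sum_{l_1=0}^{s^z_1-k_1}\cdots\sum_{l_n=0}^{s^z_n-k_n}(-D_{x^1})^{l_1}\cdots(-D_{x^n})^{l_n}\Big(\frac{\partial L}{\partial z_{(k_1+l_1,\ldots,k_i+l_i+1,\ldots,k_n+l_n)}}\Big),$$ where $z$ runs over all dependent variables $u^\alpha,\widetilde u^{\widetilde\alpha},v^\alpha,\widetilde v^{\widetilde\alpha}$, $W^z$ is the coefficient of $\partial_z$ in $Y$ minus $\sum_i\xi^iz_{x^i}$, $s^z_i$ is the highest order of differentiation with respect to $x^i$ among the derivatives of $z$ occurring in $L$, and the index $(k_1+l_1,\ldots,k_i+l_i+1,\ldots,k_n+l_n)$ gives the number of differentiations of $z$ with respect to $x^1,\ldots,x^n$.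
   Formalization: The displayed formula for C fails when L has mixed derivatives (L = v(u_x+u_xy), X = ∂_u), so each (k,l) summand gets a multinomial weight (classical symmetric formula); the displayed formula itself is asserted only when L has no mixed derivatives. *)

theory Defs
  imports "HOL-Analysis.Analysis" "HOL-Library.Groups_Big_Fun"
begin

section \<open>Smooth functions of (possibly infinitely many) real coordinates\<close>

definition pderiv_at :: "'i \<Rightarrow> (('i \<Rightarrow> real) \<Rightarrow> real) \<Rightarrow> ('i \<Rightarrow> real) \<Rightarrow> real" where
  "pderiv_at c f p = deriv (\<lambda>t. f (p(c := t))) (p c)"

text \<open>All iterated partial derivatives exist and are continuous (for the product topology) on
  the open set \<open>S\<close>.\<close>

definition smooth_on :: "('i \<Rightarrow> real) set \<Rightarrow> (('i \<Rightarrow> real) \<Rightarrow> real) \<Rightarrow> bool" where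
  "smooth_on S f \<longleftrightarrow>
     (\<forall>cs. continuous_on S (foldr pderiv_at cs f) \<and>
           (\<forall>c. \<forall>p\<in>S. (\<lambda>t. foldr pderiv_at cs f (p(c := t))) differentiable (at (p c))))"


section \<open>Jet space and differential functions\<close>

text \<open>The independent variables are indexed by a type of class \<open>finite\<close> and \<open>linorder\<close> (the
  set \<open>{1,\<dots>,n}\<close> up to isomorphism).  The dependent variables are indexed from \<open>1\<close>;
  only those with index at most \<open>m\<close>, respectively \<open>mt\<close>, are variables of the problem, so that
  there may be no variables with a tilde (\<open>mt = 0\<close>).  \<open>Dep z J\<close> is the coordinate
  \<open>z\<^sub>J\<close>, where \<open>J i\<close> is the number of differentiations with respect to \<open>x\<^sup>i\<close>.\<close>

datatype dep = Var_u nat | Var_ut nat | Var_v nat | Var_vt nat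

datatype 'n coord = Indep 'n | Dep dep "'n \<Rightarrow> nat"

type_synonym 'n jet = "'n coord \<Rightarrow> real"
type_synonym 'n dfun = "'n jet \<Rightarrow> real"

definition base_vars :: "nat \<Rightarrow> nat \<Rightarrow> dep set" where
  "base_vars m mt = Var_u ` {1..m} \<union> Var_ut ` {1..mt}"

definition all_vars :: "nat \<Rightarrow> nat \<Rightarrow> dep set" where
  "all_vars m mt = base_vars m mt \<union> Var_v ` {1..m} \<union> Var_vt ` {1..mt}"

definition jet_coords :: "dep set \<Rightarrow> 'n coord set" where
  "jet_coords Z = range Indep \<union> {Dep z J | z J. z \<in> Z}"

definition point_coords :: "dep set \<Rightarrow> 'n coord set" where
  "point_coords Z = range Indep \<union> {Dep z (\<lambda>_. 0) | z. z \<in> Z}"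

text \<open>Smooth functions, on an open domain \<open>\<U>\<close> of jet space, of finitely many of the
  coordinates in \<open>Cs\<close>.  Differential functions of the dependent variables in \<open>Z\<close> are those with
  \<open>Cs = jet_coords Z\<close>.\<close>

definition diff_fun :: "'n jet set \<Rightarrow> 'n coord set \<Rightarrow> 'n dfun \<Rightarrow> bool" where
  "diff_fun \<U> Cs f \<longleftrightarrow>
     smooth_on \<U> f \<and>
     (\<exists>S\<subseteq>Cs. finite S \<and> (\<forall>p\<in>\<U>. \<forall>q\<in>\<U>. (\<forall>c\<in>S. p c = q c) \<longrightarrow> f p = f q))"

text \<open>\<open>Sum_any\<close> sums over the indices with a nonzero summand; there are finitely many of them
  when the functions are differential functions.\<close>

definition total_deriv :: "'n \<Rightarrow> 'n dfun \<Rightarrow> 'n dfun" where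
  "total_deriv i f p =
     pderiv_at (Indep i) f p
     + Sum_any (\<lambda>(z, J). p (Dep z (J(i := Suc (J i)))) * pderiv_at (Dep z J) f p)"

definition total_deriv_multi :: "('n::{finite,linorder} \<Rightarrow> nat) \<Rightarrow> 'n dfun \<Rightarrow> 'n dfun" where
  "total_deriv_multi J = foldr (\<lambda>i. total_deriv i ^^ J i) (sorted_list_of_set UNIV)"

definition divergence :: "('n::finite \<Rightarrow> 'n dfun) \<Rightarrow> 'n dfun" where
  "divergence C p = (\<Sum>i\<in>UNIV. total_deriv i (C i) p)"

definition order_of :: "('n::finite \<Rightarrow> nat) \<Rightarrow> nat" where
  "order_of J = (\<Sum>i\<in>UNIV. J i)"

definition var_deriv :: "dep \<Rightarrow> 'n::{finite,linorder} dfun \<Rightarrow> 'n dfun" where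
  "var_deriv z L p =
     Sum_any (\<lambda>J. (-1) ^ order_of J * total_deriv_multi J (pderiv_at (Dep z J) L) p)"


section \<open>Operators and their prolongation\<close>

definition characteristic :: "('n::finite \<Rightarrow> 'n dfun) \<Rightarrow> (dep \<Rightarrow> 'n dfun) \<Rightarrow> dep \<Rightarrow> 'n dfun" where
  "characteristic \<xi> \<zeta> z p = \<zeta> z p - (\<Sum>i\<in>UNIV. \<xi> i p * p (Dep z ((\<lambda>_. 0)(i := 1))))"

definition prolong ::
  "('n::{finite,linorder} \<Rightarrow> 'n dfun) \<Rightarrow> (dep \<Rightarrow> 'n dfun) \<Rightarrow> 'n dfun \<Rightarrow> 'n dfun" where
  "prolong \<xi> \<zeta> f p =
     (\<Sum>i\<in>UNIV. \<xi> i p * total_deriv i f p)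
     + Sum_any (\<lambda>(z, J). total_deriv_multi J (characteristic \<xi> \<zeta> z) p * pderiv_at (Dep z J) f p)"

primrec op_coeffs ::
  "(nat \<Rightarrow> 'n dfun) \<Rightarrow> (nat \<Rightarrow> 'n dfun) \<Rightarrow> (nat \<Rightarrow> 'n dfun) \<Rightarrow> (nat \<Rightarrow> 'n dfun) \<Rightarrow> dep \<Rightarrow> 'n dfun"
where
  "op_coeffs \<eta> \<eta>t \<eta>s \<eta>ts (Var_u b) = \<eta> b"
| "op_coeffs \<eta> \<eta>t \<eta>s \<eta>ts (Var_ut b) = \<eta>t b"
| "op_coeffs \<eta> \<eta>t \<eta>s \<eta>ts (Var_v b) = \<eta>s b"
| "op_coeffs \<eta> \<eta>t \<eta>s \<eta>ts (Var_vt b) = \<eta>ts b"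

text \<open>\<open>lam \<nu> \<mu> [i\<^sub>1, \<dots>, i\<^sub>k]\<close> is the coefficient of \<open>D\<^sub>i\<^sub>1 \<dots> D\<^sub>i\<^sub>k\<close> in the differential
  operator with indices \<open>\<nu>\<close>, \<open>\<mu>\<close>, and \<open>r\<close> is a bound for the orders \<open>k\<close>; coefficients with
  longer index lists are ignored.\<close>

definition diff_op :: "nat \<Rightarrow> ('n::finite list \<Rightarrow> 'n dfun) \<Rightarrow> 'n dfun \<Rightarrow> 'n dfun" where
  "diff_op r l f p =
     l [] p * f p + (\<Sum>k=1..r. \<Sum>I\<in>{I. length I = k}. l I p * foldr total_deriv I f p)"

definition admitted ::
  "'n::{finite,linorder} coord set \<Rightarrow> 'n jet set \<Rightarrow> nat \<Rightarrow> nat \<Rightarrow> (nat \<Rightarrow> 'n dfun)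
   \<Rightarrow> nat \<Rightarrow> (nat \<Rightarrow> nat \<Rightarrow> 'n list \<Rightarrow> 'n dfun)
   \<Rightarrow> ('n \<Rightarrow> 'n dfun) \<Rightarrow> (nat \<Rightarrow> 'n dfun) \<Rightarrow> (nat \<Rightarrow> 'n dfun) \<Rightarrow> bool" where
  "admitted Cs \<U> m mt F r lam \<xi> \<eta> \<eta>t \<longleftrightarrow>
     (\<forall>i. diff_fun \<U> Cs (\<xi> i)) \<and>
     (\<forall>b\<in>{1..m}. diff_fun \<U> Cs (\<eta> b)) \<and>
     (\<forall>b\<in>{1..mt}. diff_fun \<U> Cs (\<eta>t b)) \<and>
     (\<forall>\<nu>\<in>{1..m}. \<forall>\<mu>\<in>{1..m}. \<forall>I. length I \<le> r \<longrightarrow>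
        diff_fun \<U> (jet_coords (base_vars m mt)) (lam \<nu> \<mu> I)) \<and>
     (\<forall>\<nu>\<in>{1..m}. \<forall>p\<in>\<U>.
        prolong \<xi> (op_coeffs \<eta> \<eta>t (\<lambda>_ _. 0) (\<lambda>_ _. 0)) (F \<nu>) p
        = (\<Sum>\<mu>=1..m. diff_op r (lam \<nu> \<mu>) (F \<mu>) p))"

definition lie_backlund_operator where
  "lie_backlund_operator \<U> m mt F r lam \<xi> \<eta> \<eta>t \<longleftrightarrow>
     admitted (jet_coords (base_vars m mt)) \<U> m mt F r lam \<xi> \<eta> \<eta>t"

definition point_symmetry_generator where
  "point_symmetry_generator \<U> m mt F r lam \<xi> \<eta> \<eta>t \<longleftrightarrow>
     r = 0 \<and> admitted (point_coords (base_vars m mt)) \<U> m mt F r lam \<xi> \<eta> \<eta>t"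


section \<open>Lagrangian, adjoint equations and conserved vectors\<close>

definition lagrangian :: "nat \<Rightarrow> nat \<Rightarrow> (nat \<Rightarrow> 'n dfun) \<Rightarrow> 'n dfun" where
  "lagrangian m mt F p =
     (\<Sum>\<beta>=1..m. p (Dep (Var_v \<beta>) (\<lambda>_. 0)) * F \<beta> p)
     + (\<Sum>\<beta>=1..mt. p (Dep (Var_vt \<beta>) (\<lambda>_. 0))) * (\<Sum>\<nu>=1..m. F \<nu> p)"

definition adj :: "nat \<Rightarrow> nat \<Rightarrow> (nat \<Rightarrow> 'n::{finite,linorder} dfun) \<Rightarrow> nat \<Rightarrow> 'n dfun" where
  "adj m mt F \<alpha> = var_deriv (Var_u \<alpha>) (lagrangian m mt F)"

definition adj_t :: "nat \<Rightarrow> nat \<Rightarrow> (nat \<Rightarrow> 'n::{finite,linorder} dfun) \<Rightarrow> nat \<Rightarrow> 'n dfun" where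
  "adj_t m mt F \<alpha> = var_deriv (Var_ut \<alpha>) (lagrangian m mt F)"

definition adjoint_extension ::
  "'n::{finite,linorder} jet set \<Rightarrow> nat \<Rightarrow> nat \<Rightarrow> nat \<Rightarrow> (nat \<Rightarrow> nat \<Rightarrow> 'n list \<Rightarrow> 'n dfun)
   \<Rightarrow> ('n \<Rightarrow> 'n dfun) \<Rightarrow> (nat \<Rightarrow> 'n dfun) \<Rightarrow> (nat \<Rightarrow> 'n dfun) \<Rightarrow> bool" where
  "adjoint_extension \<U> m mt r lam \<xi> \<eta>s \<eta>ts \<longleftrightarrow>
     (\<forall>\<beta>\<in>{1..m}. diff_fun \<U> (jet_coords (all_vars m mt)) (\<eta>s \<beta>)) \<and>
     (\<forall>\<beta>\<in>{1..mt}. diff_fun \<U> (jet_coords (all_vars m mt)) (\<eta>ts \<beta>)) \<and>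
     (let w = (\<lambda>\<alpha> p. p (Dep (Var_v \<alpha>) (\<lambda>_. 0)) + (\<Sum>\<beta>=1..mt. p (Dep (Var_vt \<beta>) (\<lambda>_. 0))))
      in \<forall>\<beta>\<in>{1..m}. \<forall>p\<in>\<U>.
        \<eta>s \<beta> p + (\<Sum>b=1..mt. \<eta>ts b p)
        = - (w \<beta> p * divergence \<xi> p
             + (\<Sum>\<mu>=1..m. w \<mu> p * lam \<mu> \<beta> [] p
                 + (\<Sum>k=1..r. (-1) ^ k *
                     (\<Sum>I\<in>{I. length I = k}.
                        foldr total_deriv I (\<lambda>q. w \<mu> q * lam \<mu> \<beta> I q) p)))))"

definition invariance_criterion where
  "invariance_criterion \<U> \<xi> \<zeta> L B \<longleftrightarrow>
     (\<forall>p\<in>\<U>. prolong \<xi> \<zeta> L p + L p * divergence \<xi> p = divergence B p)"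

text \<open>A solution consists of smooth functions on an open set \<open>\<Omega>\<close> of values of the independent
  variables; \<open>jet_of \<phi> x\<close> collects \<open>x\<close> and all partial derivatives at \<open>x\<close>.\<close>

definition jet_of ::
  "(dep \<Rightarrow> ('n::{finite,linorder} \<Rightarrow> real) \<Rightarrow> real) \<Rightarrow> ('n \<Rightarrow> real) \<Rightarrow> 'n jet" where
  "jet_of \<phi> x c =
     (case c of Indep i \<Rightarrow> x i
      | Dep z J \<Rightarrow> foldr (\<lambda>i. pderiv_at i ^^ J i) (sorted_list_of_set UNIV) (\<phi> z) x)"

definition solution ::
  "'n::{finite,linorder} jet set \<Rightarrow> nat \<Rightarrow> nat \<Rightarrow> (nat \<Rightarrow> 'n dfun)
   \<Rightarrow> ('n \<Rightarrow> real) set \<Rightarrow> (dep \<Rightarrow> ('n \<Rightarrow> real) \<Rightarrow> real) \<Rightarrow> bool" where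
  "solution \<U> m mt F \<Omega> \<phi> \<longleftrightarrow>
     open \<Omega> \<and> (\<forall>z\<in>all_vars m mt. smooth_on \<Omega> (\<phi> z)) \<and>
     (\<forall>x\<in>\<Omega>. jet_of \<phi> x \<in> \<U> \<and>
        (\<forall>\<alpha>\<in>{1..m}. F \<alpha> (jet_of \<phi> x) = 0) \<and>
        (\<forall>\<alpha>\<in>{1..m}. adj m mt F \<alpha> (jet_of \<phi> x) = 0) \<and>
        (\<forall>\<alpha>\<in>{1..mt}. adj_t m mt F \<alpha> (jet_of \<phi> x) = 0))"

definition conserved_vector ::
  "'n::{finite,linorder} jet set \<Rightarrow> nat \<Rightarrow> nat \<Rightarrow> (nat \<Rightarrow> 'n dfun) \<Rightarrow> ('n \<Rightarrow> 'n dfun) \<Rightarrow> bool" where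
  "conserved_vector \<U> m mt F C \<longleftrightarrow>
     (\<forall>i. diff_fun \<U> (jet_coords (all_vars m mt)) (C i)) \<and>
     (\<forall>\<Omega> \<phi>. solution \<U> m mt F \<Omega> \<phi> \<longrightarrow> (\<forall>x\<in>\<Omega>. divergence C (jet_of \<phi> x) = 0))"


section \<open>The Noether vector\<close>

definition occurs :: "'n jet set \<Rightarrow> 'n dfun \<Rightarrow> dep \<Rightarrow> ('n \<Rightarrow> nat) \<Rightarrow> bool" where
  "occurs \<U> L z J \<longleftrightarrow> (\<exists>p\<in>\<U>. pderiv_at (Dep z J) L p \<noteq> 0)"

text \<open>On natural numbers, \<open>Sup {} = 0\<close>.\<close>

definition top_order :: "'n jet set \<Rightarrow> 'n dfun \<Rightarrow> dep \<Rightarrow> 'n \<Rightarrow> nat" where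
  "top_order \<U> L z i = Sup {J i | J. occurs \<U> L z J}"

definition no_mixed_derivatives :: "'n jet set \<Rightarrow> dep set \<Rightarrow> 'n dfun \<Rightarrow> bool" where
  "no_mixed_derivatives \<U> Z L \<longleftrightarrow>
     (\<forall>z\<in>Z. \<forall>J. occurs \<U> L z J \<longrightarrow> (\<exists>i. \<forall>j. j \<noteq> i \<longrightarrow> J j = 0))"

text \<open>The argument \<open>wt\<close> is a weight for the summand with indices \<open>i\<close>, \<open>K = (k\<^sub>1,\<dots>,k\<^sub>n)\<close>,
  \<open>M = (l\<^sub>1,\<dots>,l\<^sub>n)\<close>.  The factor \<open>(-1)\<close> to the power \<open>order_of M\<close> collects the signs of the
  operators \<open>(- D)\<^sup>l\<close>.  The constant weight \<open>1\<close> gives the unweighted multi-index sum.\<close>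

definition noether_vector ::
  "('n \<Rightarrow> ('n \<Rightarrow> nat) \<Rightarrow> ('n \<Rightarrow> nat) \<Rightarrow> real) \<Rightarrow> 'n::{finite,linorder} jet set \<Rightarrow> dep set
   \<Rightarrow> ('n \<Rightarrow> 'n dfun) \<Rightarrow> (dep \<Rightarrow> 'n dfun) \<Rightarrow> 'n dfun \<Rightarrow> ('n \<Rightarrow> 'n dfun) \<Rightarrow> 'n \<Rightarrow> 'n dfun" where
  "noether_vector wt \<U> Z \<xi> \<zeta> L B i p =
     - B i p + \<xi> i p * L p
     + (\<Sum>z\<in>Z. \<Sum>K\<in>{K. (\<forall>j. K j \<le> top_order \<U> L z j) \<and> K i < top_order \<U> L z i}.
          total_deriv_multi K (characteristic \<xi> \<zeta> z) p
          * (\<Sum>M\<in>{M. \<forall>j. M j \<le> top_order \<U> L z j - K j}.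
               wt i K M * ((-1) ^ order_of M
               * total_deriv_multi M
                   (pderiv_at (Dep z ((\<lambda>j. K j + M j)(i := Suc (K i + M i)))) L) p)))"

definition multinom :: "('n::finite \<Rightarrow> nat) \<Rightarrow> real" where
  "multinom J = fact (order_of J) / (\<Prod>i\<in>UNIV. fact (J i))"

text \<open>Written with index tuples, the classical formula is the sum of
  \<open>D\<^sub>j\<^sub>1 \<dots> D\<^sub>j\<^sub>k (W) (-D\<^sub>h\<^sub>1) \<dots> (-D\<^sub>h\<^sub>l) (\<partial>L / \<partial>z\<^sub>i\<^sub>j\<^sub>1\<^sub>\<dots>\<^sub>h\<^sub>l)\<close> over all tuples, with \<open>L\<close> written symmetrically
  in the mixed derivatives (\<open>z\<^sub>x\<^sub>y\<close> as half the sum of \<open>z\<^sub>x\<^sub>y\<close> and \<open>z\<^sub>y\<^sub>x\<close>).  In multi-index notation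
  \<open>K\<close> and \<open>M\<close> stand for \<open>multinom K\<close> and \<open>multinom M\<close> tuples, and the symmetric
  \<open>\<partial>L / \<partial>z\<^sub>J\<close> is the multi-index derivative divided by \<open>multinom J\<close>.  Without these factors
  Noether's identity fails as soon as \<open>L\<close> contains a mixed derivative: for
  \<open>L = v (u\<^sub>x + u\<^sub>x\<^sub>y)\<close> and the symmetry \<open>\<partial>\<^sub>u\<close>, the unweighted vector \<open>(v - v\<^sub>y, - v\<^sub>x)\<close> has divergence
  \<open>- v\<^sub>x\<close> on solutions.  All factors are \<open>1\<close> when there are no mixed derivatives.\<close>

definition noether_weight :: "'n::finite \<Rightarrow> ('n \<Rightarrow> nat) \<Rightarrow> ('n \<Rightarrow> nat) \<Rightarrow> real" where
  "noether_weight i K M =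
     multinom K * multinom M / multinom ((\<lambda>j. K j + M j)(i := Suc (K i + M i)))"

end

theory Submission
  imports Defs
begin

text \<open>
  Write \<open>L = \<Sum>\<^sub>\<beta> w\<^sup>\<beta> F\<^sub>\<beta>\<close> with \<open>w\<^sup>\<beta> = v\<^sup>\<beta> + \<Sum> vt\<close>.  Total derivatives and prolongations are derivations of the algebra
  of differential functions, so \<open>Pr Y (L) + L div \<xi>\<close> is a sum of terms \<open>w D\<^sub>\<nu>\<^sub>\<mu>(F) - F D\<^sub>\<nu>\<^sub>\<mu>\<^sup>*(w)\<close>: the condition on
  \<open>\<eta>s\<close>, \<open>\<eta>ts\<close> is made for the formal adjoints \<open>D\<^sub>\<nu>\<^sub>\<mu>\<^sup>*\<close> to appear.  Integration by parts turns each term into a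
  divergence, which gives \<open>B\<close>.  Integrating by parts in \<open>Pr Y (L)\<close> itself gives Noether's identity
  \<open>div C = - \<Sum>\<^sub>z W\<^sup>z \<delta>L/\<delta>z\<close>, whose right-hand side vanishes on solutions since
  \<open>\<delta>L/\<delta>v\<^sup>\<beta> = F\<^sub>\<beta>\<close> and \<open>\<delta>L/\<delta>vt = \<Sum>\<^sub>\<nu> F\<^sub>\<nu>\<close>.
\<close>

section \<open>Partial derivatives of smooth functions\<close>

text \<open>Everything up to the last step is proved off shell: the identities hold at each point of
  \<open>\<U>\<close>, and solutions enter only when their jets are inserted. Outside
  \<open>\<U>\<close> nothing is known about the functions, so an identity can be differentiated
  only because \<open>\<U>\<close> is open and a coordinate line through a point of
  \<open>\<U>\<close> stays in it for a while.

  There are infinitely many coordinates, but a differential function depends on finitely many of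
  them. This makes every operator a finite sum on each given function, although no finite set of
  coordinates serves all functions.

  The obstacle is combinatorial. The splittings \<open>A + B = J\<close> of a multi-index form a
  grid and not a chain, so moving derivatives one at a time from \<open>W\<close> to
  \<open>\<partial>L / \<partial>z\<^sub>J\<close> can follow many paths, and an unweighted sum over
  the steps does not telescope. There are \<open>multinom J\<close> words with content
  \<open>J\<close>; those consisting of a word of content \<open>K\<close>, the letter
  \<open>i\<close> and a word of content \<open>M\<close> number
  \<open>multinom K * multinom M\<close>. The Noether weight is the share of these words: each step
  counts in proportion to the paths that use it.\<close>

lemma eventually_upd_in:
  fixes p :: "'i \<Rightarrow> real"
  assumes "open \<U>" "p \<in> \<U>"
  shows "eventually (\<lambda>t. p(c := t) \<in> \<U>) (nhds (p c))"
proof -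
  have "continuous_on UNIV (\<lambda>t. p(c := t))"
  proof (rule continuous_on_coordinatewise_then_product)
    show "continuous_on UNIV (\<lambda>t. (p(c := t)) d)" for d
      by (cases "d = c") (auto intro: continuous_intros)
  qed
  then have "open ((\<lambda>t. p(c := t)) -` \<U>)"
    using assms(1) by (rule open_vimage[rotated])
  moreover have "p c \<in> (\<lambda>t. p(c := t)) -` \<U>"
    using assms(2) by simp
  ultimately show ?thesis
    unfolding eventually_nhds by blast
qed

lemma pderiv_at_cong:
  assumes "open \<U>" "p \<in> \<U>" "\<And>q. q \<in> \<U> \<Longrightarrow> f q = g q"
  shows "pderiv_at c f p = pderiv_at c g p"
  unfolding pderiv_at_def
  by (intro deriv_cong_ev refl eventually_mono[OF eventually_upd_in[OF assms(1,2)]] assms(3))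

lemma iterated_pderiv_at_cong:
  assumes "open \<U>" "p \<in> \<U>" "\<And>q. q \<in> \<U> \<Longrightarrow> f q = g q"
  shows "foldr pderiv_at cs f p = foldr pderiv_at cs g p"
  using assms(2)
proof (induction cs arbitrary: p)
  case (Cons c cs)
  show ?case
    unfolding foldr.simps comp_apply
    by (rule pderiv_at_cong[OF assms(1) Cons.prems]) (rule Cons.IH)
qed (simp add: assms(3))

lemma pderiv_at_DERIV:
  assumes "(\<lambda>t. f (p(c := t))) differentiable (at (p c))"
  shows "((\<lambda>t. f (p(c := t))) has_real_derivative pderiv_at c f p) (at (p c))"
  using assms unfolding pderiv_at_def by (simp add: DERIV_deriv_iff_real_differentiable)

lemma differentiable_upd_cong:
  fixes f g :: "('i \<Rightarrow> real) \<Rightarrow> real"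
  assumes "open \<U>" "p \<in> \<U>" "\<And>q. q \<in> \<U> \<Longrightarrow> f q = g q"
    and "(\<lambda>t. f (p(c := t))) differentiable (at (p c))"
  shows "(\<lambda>t. g (p(c := t))) differentiable (at (p c))"
proof -
  have "((\<lambda>t. g (p(c := t))) has_real_derivative pderiv_at c f p) (at (p c))"
    by (rule DERIV_cong_ev[THEN iffD1, OF refl _ refl pderiv_at_DERIV[OF assms(4)]])
       (intro eventually_mono[OF eventually_upd_in[OF assms(1,2)]] assms(3))
  then show ?thesis
    unfolding real_differentiable_def by (rule exI)
qed

lemma smooth_on_imp_continuous_on: "smooth_on \<U> f \<Longrightarrow> continuous_on \<U> f"
  unfolding smooth_on_def by (drule spec[of _ "[]"]) simp

lemma smooth_on_pderiv_at:
  assumes "smooth_on \<U> f"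
  shows "smooth_on \<U> (pderiv_at c f)"
  unfolding smooth_on_def
proof
  fix cs
  show "continuous_on \<U> (foldr pderiv_at cs (pderiv_at c f)) \<and>
    (\<forall>d. \<forall>p\<in>\<U>. (\<lambda>t. foldr pderiv_at cs (pderiv_at c f) (p(d := t))) differentiable at (p d))"
    \<comment> \<open>\<open>foldr\<close> applies the last index first, so appending
      \<open>c\<close> makes it the innermost derivative.\<close>
    using assms[unfolded smooth_on_def, rule_format, of "cs @ [c]"] by simp
qed

lemma smooth_on_differentiable:
  "smooth_on \<U> f \<Longrightarrow> p \<in> \<U> \<Longrightarrow> (\<lambda>t. f (p(c := t))) differentiable (at (p c))"
  unfolding smooth_on_def by (drule spec[of _ "[]"]) simp

text \<open>The base value is moved from \<open>p c\<close> to an arbitrary \<open>s\<close>, the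
  form in which the mean value theorem is applied along a coordinate line.\<close>

lemma smooth_on_DERIV:
  assumes "smooth_on \<U> f" "p(c := s) \<in> \<U>"
  shows "((\<lambda>t. f (p(c := t))) has_real_derivative pderiv_at c f (p(c := s))) (at s)"
  using pderiv_at_DERIV[OF smooth_on_differentiable[OF assms], of c]
  by (simp only: fun_upd_same fun_upd_upd)

section \<open>Rules for partial derivatives, and closure of smooth functions under sums and
  products\<close>

lemma pderiv_at_const: "pderiv_at c (\<lambda>_. a) p = 0"
  by (simp add: pderiv_at_def)

lemma pderiv_at_coord: "pderiv_at c (\<lambda>p. p d) p = (if c = d then 1 else 0)"
  by (simp add: pderiv_at_def)

text \<open>Differentiability is assumed along a single coordinate line, because the rule is used
  before sums are known to be smooth.\<close>

lemma upd_differentiable_add: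
  assumes "(\<lambda>t. f (p(c := t))) differentiable (at (p c))" "(\<lambda>t. g (p(c := t))) differentiable (at (p c))"
  shows "(\<lambda>t. f (p(c := t)) + g (p(c := t))) differentiable (at (p c))"
    and "pderiv_at c (\<lambda>q. f q + g q) p = pderiv_at c f p + pderiv_at c g p"
proof -
  have *: "((\<lambda>t. f (p(c := t)) + g (p(c := t))) has_real_derivative
      pderiv_at c f p + pderiv_at c g p) (at (p c))"
    by (intro DERIV_add pderiv_at_DERIV assms)
  then show "(\<lambda>t. f (p(c := t)) + g (p(c := t))) differentiable (at (p c))"
    unfolding real_differentiable_def by (rule exI)
  show "pderiv_at c (\<lambda>q. f q + g q) p = pderiv_at c f p + pderiv_at c g p"
    unfolding pderiv_at_def[of c "\<lambda>q. f q + g q"] by (rule DERIV_imp_deriv[OF *])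
qed

lemma upd_differentiable_mult:
  assumes "(\<lambda>t. f (p(c := t))) differentiable (at (p c))" "(\<lambda>t. g (p(c := t))) differentiable (at (p c))"
  shows "(\<lambda>t. f (p(c := t)) * g (p(c := t))) differentiable (at (p c))"
    and "pderiv_at c (\<lambda>q. f q * g q) p = pderiv_at c f p * g p + f p * pderiv_at c g p"
proof -
  have *: "((\<lambda>t. f (p(c := t)) * g (p(c := t))) has_real_derivative
      pderiv_at c f p * g (p(c := p c)) + pderiv_at c g p * f (p(c := p c))) (at (p c))"
    by (intro DERIV_mult pderiv_at_DERIV assms)
  then show "(\<lambda>t. f (p(c := t)) * g (p(c := t))) differentiable (at (p c))"
    unfolding real_differentiable_def by (rule exI)
  show "pderiv_at c (\<lambda>q. f q * g q) p = pderiv_at c f p * g p + f p * pderiv_at c g p"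
    unfolding pderiv_at_def[of c "\<lambda>q. f q * g q"] DERIV_imp_deriv[OF *]
    by (simp only: fun_upd_triv mult.commute)
qed

lemma pderiv_at_add:
  assumes "smooth_on \<U> f" "smooth_on \<U> g" "p \<in> \<U>"
  shows "pderiv_at c (\<lambda>q. f q + g q) p = pderiv_at c f p + pderiv_at c g p"
  using assms by (intro upd_differentiable_add smooth_on_differentiable)

lemma pderiv_at_mult:
  assumes "smooth_on \<U> f" "smooth_on \<U> g" "p \<in> \<U>"
  shows "pderiv_at c (\<lambda>q. f q * g q) p = pderiv_at c f p * g p + f p * pderiv_at c g p"
  using assms by (intro upd_differentiable_mult smooth_on_differentiable)

text \<open>A class that contains the smooth functions and that differentiation does not leave: by
  the product rule a derivative of a product is again a sum of products. Induction on the number of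
  derivatives then works inside the class and avoids a Leibniz formula for iterated
  derivatives.\<close>

inductive smooth_generated :: "('i \<Rightarrow> real) set \<Rightarrow> (('i \<Rightarrow> real) \<Rightarrow> real) \<Rightarrow> bool" for \<U> where
  smooth: "smooth_on \<U> f \<Longrightarrow> smooth_generated \<U> f"
| add: "smooth_generated \<U> f \<Longrightarrow> smooth_generated \<U> g \<Longrightarrow> smooth_generated \<U> (\<lambda>p. f p + g p)"
| mult: "smooth_generated \<U> f \<Longrightarrow> smooth_generated \<U> g \<Longrightarrow> smooth_generated \<U> (\<lambda>p. f p * g p)"

lemma smooth_generated_continuous_on: "smooth_generated \<U> f \<Longrightarrow> continuous_on \<U> f"
  by (induction rule: smooth_generated.induct)
     (auto intro: continuous_intros smooth_on_imp_continuous_on)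

lemma smooth_generated_differentiable:
  assumes "smooth_generated \<U> f" "p \<in> \<U>"
  shows "(\<lambda>t. f (p(c := t))) differentiable (at (p c))"
  using assms(1)
proof induction
  case (smooth f)
  then show ?case using assms(2) by (rule smooth_on_differentiable)
next
  case (add f g)
  show ?case by (rule upd_differentiable_add(1)[OF add.IH])
next
  case (mult f g)
  show ?case by (rule upd_differentiable_mult(1)[OF mult.IH])
qed

text \<open>The derivative is matched with a member of the class on \<open>\<U>\<close> only, since
  the sum and product rules are available only there.\<close>

lemma smooth_generated_pderiv_at:
  assumes "smooth_generated \<U> f"
  shows "\<exists>g. smooth_generated \<U> g \<and> (\<forall>p\<in>\<U>. pderiv_at c f p = g p)"
  using assms
proof induction
  case (smooth f)
  then have "smooth_generated \<U> (pderiv_at c f)"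
    by (intro smooth_generated.smooth smooth_on_pderiv_at)
  then show ?case by blast
next
  case (add f g)
  then obtain f' g' where *: "smooth_generated \<U> f'" "\<And>p. p \<in> \<U> \<Longrightarrow> pderiv_at c f p = f' p"
    "smooth_generated \<U> g'" "\<And>p. p \<in> \<U> \<Longrightarrow> pderiv_at c g p = g' p"
    by blast
  have "pderiv_at c (\<lambda>p. f p + g p) p = f' p + g' p" if "p \<in> \<U>" for p
    using upd_differentiable_add(2)[OF smooth_generated_differentiable[OF add.hyps(1) that]
        smooth_generated_differentiable[OF add.hyps(2) that], of c] *(2,4)[OF that] by simp
  moreover have "smooth_generated \<U> (\<lambda>p. f' p + g' p)"
    by (intro smooth_generated.add *)
  ultimately show ?case by blast
next
  case (mult f g)
  then obtain f' g' where *: "smooth_generated \<U> f'" "\<And>p. p \<in> \<U> \<Longrightarrow> pderiv_at c f p = f' p"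
    "smooth_generated \<U> g'" "\<And>p. p \<in> \<U> \<Longrightarrow> pderiv_at c g p = g' p"
    by blast
  have "pderiv_at c (\<lambda>p. f p * g p) p = f' p * g p + f p * g' p" if "p \<in> \<U>" for p
    using upd_differentiable_mult(2)[OF smooth_generated_differentiable[OF mult.hyps(1) that]
        smooth_generated_differentiable[OF mult.hyps(2) that], of c] *(2,4)[OF that] by simp
  moreover have "smooth_generated \<U> (\<lambda>p. f' p * g p + f p * g' p)"
    by (intro smooth_generated.add smooth_generated.mult * mult.hyps)
  ultimately show ?case by blast
qed

lemma smooth_generated_imp_smooth_on:
  assumes "open \<U>" "smooth_generated \<U> f"
  shows "smooth_on \<U> f"
proof -
  have *: "\<exists>g. smooth_generated \<U> g \<and> (\<forall>p\<in>\<U>. foldr pderiv_at cs f p = g p)" for cs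
  proof (induction cs)
    case Nil
    then show ?case using assms(2) by auto
  next
    case (Cons c cs)
    then obtain g where g: "smooth_generated \<U> g" "\<forall>p\<in>\<U>. foldr pderiv_at cs f p = g p"
      by blast
    obtain h where h: "smooth_generated \<U> h" "\<forall>p\<in>\<U>. pderiv_at c g p = h p"
      using smooth_generated_pderiv_at[OF g(1), of c] by blast
    have "pderiv_at c (foldr pderiv_at cs f) p = pderiv_at c g p" if "p \<in> \<U>" for p
      by (rule pderiv_at_cong[OF assms(1) that]) (rule g(2)[rule_format])
    with h have "\<forall>p\<in>\<U>. foldr pderiv_at (c # cs) f p = h p"
      by simp
    with h(1) show ?case by blast
  qed
  show ?thesis
    unfolding smooth_on_def
  proof (intro allI conjI ballI)
    fix cs
    obtain g where g: "smooth_generated \<U> g" "\<forall>p\<in>\<U>. foldr pderiv_at cs f p = g p"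
      using *[of cs] by blast
    show "continuous_on \<U> (foldr pderiv_at cs f)"
      by (rule continuous_on_eq[OF smooth_generated_continuous_on[OF g(1)]]) (rule g(2)[rule_format, symmetric])
    fix c p assume p: "p \<in> \<U>"
    show "(\<lambda>t. foldr pderiv_at cs f (p(c := t))) differentiable (at (p c))"
      by (rule differentiable_upd_cong[OF assms(1) p _ smooth_generated_differentiable[OF g(1) p]])
         (rule g(2)[rule_format, symmetric])
  qed
qed

lemma smooth_on_cong:
  assumes "open \<U>" "\<And>p. p \<in> \<U> \<Longrightarrow> f p = g p" "smooth_on \<U> f"
  shows "smooth_on \<U> g"
  unfolding smooth_on_def
proof (intro allI conjI ballI)
  fix cs
  have eq: "foldr pderiv_at cs f p = foldr pderiv_at cs g p" if "p \<in> \<U>" for p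
    using iterated_pderiv_at_cong[OF assms(1) that assms(2)] .
  have f: "continuous_on \<U> (foldr pderiv_at cs f)"
    "\<And>c p. p \<in> \<U> \<Longrightarrow> (\<lambda>t. foldr pderiv_at cs f (p(c := t))) differentiable at (p c)"
    using assms(3) unfolding smooth_on_def by blast+
  show "continuous_on \<U> (foldr pderiv_at cs g)"
    by (rule continuous_on_eq[OF f(1)]) (rule eq)
  fix c p assume p: "p \<in> \<U>"
  show "(\<lambda>t. foldr pderiv_at cs g (p(c := t))) differentiable (at (p c))"
    by (rule differentiable_upd_cong[OF assms(1) p eq f(2)[OF p]])
qed

lemma smooth_on_add:
  "open \<U> \<Longrightarrow> smooth_on \<U> f \<Longrightarrow> smooth_on \<U> g \<Longrightarrow> smooth_on \<U> (\<lambda>p. f p + g p)"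
  by (rule smooth_generated_imp_smooth_on[OF _ smooth_generated.add[OF smooth_generated.smooth smooth_generated.smooth]])

lemma smooth_on_mult:
  "open \<U> \<Longrightarrow> smooth_on \<U> f \<Longrightarrow> smooth_on \<U> g \<Longrightarrow> smooth_on \<U> (\<lambda>p. f p * g p)"
  by (rule smooth_generated_imp_smooth_on[OF _ smooth_generated.mult[OF smooth_generated.smooth smooth_generated.smooth]])

lemma smooth_on_const: "smooth_on \<U> (\<lambda>_. a)"
proof -
  have c: "pderiv_at c (\<lambda>_. b) = (\<lambda>_. 0)" for c :: 'a and b
    by (rule ext) (rule pderiv_at_const)
  have *: "\<exists>b. foldr pderiv_at cs (\<lambda>_. a) = (\<lambda>_. b)" for cs :: "'a list"
  proof (induction cs)
    case (Cons d cs)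
    then obtain b where b: "foldr pderiv_at cs (\<lambda>_. a) = (\<lambda>_. b)" by blast
    have "foldr pderiv_at (d # cs) (\<lambda>_. a) = (\<lambda>_. 0)" by (simp only: foldr.simps comp_apply b c)
    then show ?case by blast
  qed auto
  show ?thesis
    unfolding smooth_on_def
  proof (intro allI conjI ballI)
    fix cs :: "'a list"
    obtain b where "foldr pderiv_at cs (\<lambda>_. a) = (\<lambda>_. b)" using *[of cs] by blast
    then show "continuous_on \<U> (foldr pderiv_at cs (\<lambda>_. a))"
      "(\<lambda>t. foldr pderiv_at cs (\<lambda>_. a) (p(c := t))) differentiable (at (p c))" for p c
      by simp_all
  qed
qed

lemma smooth_on_coord: "smooth_on \<U> (\<lambda>p. p c)"
  unfolding smooth_on_def
proof (intro allI conjI ballI)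
  fix cs
  have c: "pderiv_at d (\<lambda>p. p c) = (\<lambda>_. if d = c then 1 else 0)" for d
    by (rule ext) (rule pderiv_at_coord)
  have *: "smooth_on \<U> (\<lambda>_::'a \<Rightarrow> real. b)" for b by (rule smooth_on_const)
  have base: "continuous_on \<U> (\<lambda>p. p c)"
    "(\<lambda>t. (p(d := t)) c) differentiable (at (p d))" for d and p :: "'a \<Rightarrow> real"
    by (auto intro: continuous_on_subset[OF continuous_on_product_coordinates]) (cases "c = d"; simp)
  \<comment> \<open>The innermost derivative already turns the coordinate into a constant, so every
    nonempty list of derivatives reduces to \<open>smooth_on_const\<close>.\<close>
  have step: "foldr pderiv_at (cs @ [e]) (\<lambda>p. p c) = foldr pderiv_at cs (\<lambda>_. if e = c then 1 else 0)" for cs e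
    by (simp only: foldr_append foldr.simps comp_apply id_apply c)
  show "continuous_on \<U> (foldr pderiv_at cs (\<lambda>p. p c))"
  proof (cases cs rule: rev_cases)
    case Nil
    then show ?thesis using base(1) by simp
  next
    case (snoc ds e)
    show ?thesis
      unfolding snoc step using *[unfolded smooth_on_def] by blast
  qed
  fix d p assume "p \<in> \<U>"
  show "(\<lambda>t. foldr pderiv_at cs (\<lambda>p. p c) (p(d := t))) differentiable (at (p d))"
  proof (cases cs rule: rev_cases)
    case Nil
    then show ?thesis using base(2) by simp
  next
    case (snoc ds e)
    show ?thesis
      unfolding snoc step using *[unfolded smooth_on_def] \<open>p \<in> \<U>\<close> by blast
  qed
qed

section \<open>Symmetry of mixed partial derivatives\<close>

lemma MVT_along:
  fixes g :: "real \<Rightarrow> real"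
  assumes "h > 0" "\<And>t. a \<le> t \<Longrightarrow> t \<le> a + h \<Longrightarrow> (g has_real_derivative g' t) (at t)"
  shows "\<exists>t. a < t \<and> t < a + h \<and> g (a + h) - g a = h * g' t"
  using MVT2[of a "a + h" g g'] assms by auto

text \<open>The second difference over a square is the increment in direction \<open>c\<close> of a
  first difference in direction \<open>d\<close>. The mean value theorem, applied once in each
  direction, turns it into a mixed derivative at an interior point.\<close>

lemma second_difference:
  assumes f: "smooth_on \<U> f" and "c \<noteq> d" "h > 0"
    and U: "\<And>s t. p c \<le> s \<Longrightarrow> s \<le> p c + h \<Longrightarrow> p d \<le> t \<Longrightarrow> t \<le> p d + h \<Longrightarrow> p(c := s, d := t) \<in> \<U>"
  shows "\<exists>s t. p c < s \<and> s < p c + h \<and> p d < t \<and> t < p d + h \<and>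
     f (p(c := p c + h, d := p d + h)) - f (p(d := p d + h)) - f (p(c := p c + h)) + f p
     = h * h * pderiv_at d (pderiv_at c f) (p(c := s, d := t))"
proof -
  \<comment> \<open>The update at \<open>c\<close> is outermost because
    \<open>smooth_on_DERIV\<close> differentiates in that position; the idle \<open>d := p d\<close>
    gives both terms the same shape.\<close>
  let ?g = "\<lambda>s. f (p(d := p d + h, c := s)) - f (p(d := p d, c := s))"
  have tw: "p(c := s, d := t) = p(d := t, c := s)" for s t
    using \<open>c \<noteq> d\<close> by (rule fun_upd_twist)
  have "\<exists>s. p c < s \<and> s < p c + h \<and> ?g (p c + h) - ?g (p c) =
     h * (pderiv_at c f (p(d := p d + h, c := s)) - pderiv_at c f (p(d := p d, c := s)))"
  proof (intro MVT_along DERIV_diff smooth_on_DERIV[OF f])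
    fix s assume s: "p c \<le> s" "s \<le> p c + h"
    show "p(d := p d + h, c := s) \<in> \<U>"
      using U[OF s, of "p d + h"] \<open>h > 0\<close> by (simp add: tw del: fun_upd_apply)
    show "p(d := p d, c := s) \<in> \<U>"
      using U[OF s, of "p d"] \<open>h > 0\<close> by (simp add: tw del: fun_upd_apply)
  qed (fact \<open>h > 0\<close>)
  then obtain s where s: "p c < s" "s < p c + h" "?g (p c + h) - ?g (p c) =
     h * (pderiv_at c f (p(d := p d + h, c := s)) - pderiv_at c f (p(d := p d, c := s)))"
    by blast
  have "\<exists>t. p d < t \<and> t < p d + h \<and>
     pderiv_at c f (p(c := s, d := p d + h)) - pderiv_at c f (p(c := s, d := p d))
     = h * pderiv_at d (pderiv_at c f) (p(c := s, d := t))"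
    by (intro MVT_along smooth_on_DERIV[OF smooth_on_pderiv_at[OF f]] U)
       (use \<open>h > 0\<close> s in linarith)+
  then obtain t where t: "p d < t" "t < p d + h"
     "pderiv_at c f (p(c := s, d := p d + h)) - pderiv_at c f (p(c := s, d := p d))
     = h * pderiv_at d (pderiv_at c f) (p(c := s, d := t))"
    by blast
  have e: "p(d := p d + h, c := p c) = p(d := p d + h)" "p(d := p d, c := p c) = p"
    "p(d := p d, c := p c + h) = p(c := p c + h)"
    using \<open>c \<noteq> d\<close> by (auto simp: fun_eq_iff)
  have "f (p(c := p c + h, d := p d + h)) - f (p(d := p d + h)) - f (p(c := p c + h)) + f p
      = ?g (p c + h) - ?g (p c)"
    unfolding e tw by simp
  also have "\<dots> = h * h * pderiv_at d (pderiv_at c f) (p(c := s, d := t))"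
    unfolding s(3) using t(3) by (simp add: tw)
  finally show ?thesis
    using s t by blast
qed

text \<open>The second difference is symmetric in \<open>c\<close> and \<open>d\<close>, so the two
  mixed derivatives take a common value at two points of an arbitrarily small square at
  \<open>p\<close>; continuity moves both points to \<open>p\<close>. Continuity on the function
  space is pulled back along \<open>?P\<close> to a plane, where a neighbourhood contains such
  squares.\<close>

lemma pderiv_at_commute:
  assumes "open \<U>" "smooth_on \<U> f" "p \<in> \<U>"
  shows "pderiv_at c (pderiv_at d f) p = pderiv_at d (pderiv_at c f) p"
proof (cases "c = d")
  case False
  let ?P = "\<lambda>x::real \<times> real. p(c := fst x, d := snd x)"
  have tw: "p(c := s, d := t) = p(d := t, c := s)" for s t
    using False by (rule fun_upd_twist)
  have cont: "isCont ?P x" for x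
  proof -
    have "continuous_on UNIV ?P"
    proof (rule continuous_on_coordinatewise_then_product)
      show "continuous_on UNIV (\<lambda>x. ?P x e)" for e
        by (cases "e = d"; cases "e = c") (auto intro!: continuous_intros)
    qed
    then show ?thesis
      by (simp only: continuous_on_eq_continuous_at[OF open_UNIV] UNIV_I ball_UNIV)
  qed
  have P: "?P (p c, p d) = p"
    by auto
  have near: "eventually (\<lambda>x. ?P x \<in> V) (nhds (p c, p d))" if "open V" "p \<in> V" for V
    using topological_tendstoD[OF cont[of "(p c, p d)", unfolded isCont_def] that(1)] that(2) P
    by (auto simp: eventually_at_filter elim: eventually_mono)
  have close: "eventually (\<lambda>x. ?P x \<in> \<U> \<and> dist (g (?P x)) (g p) < e) (nhds (p c, p d))"
    if "smooth_on \<U> g" "e > 0" for g e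
  proof -
    have "open (g -` ball (g p) e \<inter> \<U>)"
      using continuous_on_open_vimage[OF assms(1), of g] smooth_on_imp_continuous_on[OF that(1)] by blast
    then have "eventually (\<lambda>x. ?P x \<in> g -` ball (g p) e \<inter> \<U>) (nhds (p c, p d))"
      by (rule near) (use assms(3) that(2) in auto)
    then show ?thesis
      by (auto elim!: eventually_mono simp: dist_commute)
  qed
  let ?f1 = "pderiv_at c (pderiv_at d f)" and ?f2 = "pderiv_at d (pderiv_at c f)"
  have "dist (?f1 p) (?f2 p) < 2 * e" if "e > 0" for e
  proof -
    have "eventually (\<lambda>x. ?P x \<in> \<U> \<and> dist (?f1 (?P x)) (?f1 p) < e \<and> dist (?f2 (?P x)) (?f2 p) < e)
        (nhds (p c, p d))"
      using close[OF smooth_on_pderiv_at[OF smooth_on_pderiv_at[OF assms(2)]] that, of c d]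
        close[OF smooth_on_pderiv_at[OF smooth_on_pderiv_at[OF assms(2)]] that, of d c]
      by eventually_elim blast
    then obtain r where r: "r > 0" "\<And>x. dist x (p c, p d) < r \<Longrightarrow>
        ?P x \<in> \<U> \<and> dist (?f1 (?P x)) (?f1 p) < e \<and> dist (?f2 (?P x)) (?f2 p) < e"
      unfolding eventually_nhds_metric by blast
    \<comment> \<open>Points of a square of side \<open>h\<close> have distance at most
      \<open>2 * h < r\<close> from its corner.\<close>
    define h where "h = r / 3"
    have h: "h > 0" "h + h < r" using r(1) by (auto simp: h_def)
    have box: "dist (s, t) (p c, p d) < r"
      if "p c \<le> s" "s \<le> p c + h" "p d \<le> t" "t \<le> p d + h" for s t
    proof -
      have "dist (s, t) (p c, p d) \<le> dist s (p c) + dist t (p d)"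
        unfolding dist_Pair_Pair by (rule sqrt_sum_squares_le_sum) auto
      then show ?thesis using that h by (auto simp: dist_real_def)
    qed
    have inU: "p(c := s, d := t) \<in> \<U>" "p(d := t, c := s) \<in> \<U>"
      if "p c \<le> s" "s \<le> p c + h" "p d \<le> t" "t \<le> p d + h" for s t
      using r(2)[OF box[OF that]] tw by auto
    let ?\<Delta> = "f (p(c := p c + h, d := p d + h)) - f (p(d := p d + h)) - f (p(c := p c + h)) + f p"
    obtain s t where 1: "p c < s" "s < p c + h" "p d < t" "t < p d + h"
      "?\<Delta> = h * h * ?f2 (p(c := s, d := t))"
      using second_difference[OF assms(2) False h(1) inU(1)] by blast
    obtain s' t' where 2: "p c < s'" "s' < p c + h" "p d < t'" "t' < p d + h"
      "?\<Delta> = h * h * ?f1 (p(c := s', d := t'))"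
      using second_difference[OF assms(2) False[symmetric] h(1) inU(2)] by (auto simp: tw)
    have "?f2 (p(c := s, d := t)) = ?f1 (p(c := s', d := t'))"
      using 1(5) 2(5) h(1) by simp
    moreover have "dist (?f2 (p(c := s, d := t))) (?f2 p) < e"
      using r(2)[OF box[of s t]] 1 by auto
    moreover have "dist (?f1 (p(c := s', d := t'))) (?f1 p) < e"
      using r(2)[OF box[of s' t']] 2 by auto
    ultimately show ?thesis
      by (simp add: dist_real_def)
  qed
  \<comment> \<open>If the distance were positive, half of it as \<open>e\<close> would make the
    distance smaller than itself.\<close>
  from this[of "dist (?f1 p) (?f2 p) / 2"] show ?thesis
    by auto
qed simp

section \<open>Differential functions\<close>

text \<open>Makes the finite set in \<open>diff_fun\<close> available by name; sums over all
  coordinates are reduced to it.\<close>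

definition depends_on :: "('i \<Rightarrow> real) set \<Rightarrow> 'i set \<Rightarrow> (('i \<Rightarrow> real) \<Rightarrow> real) \<Rightarrow> bool" where
  "depends_on \<U> S f \<longleftrightarrow> (\<forall>p\<in>\<U>. \<forall>q\<in>\<U>. (\<forall>c\<in>S. p c = q c) \<longrightarrow> f p = f q)"

lemma depends_onD: "depends_on \<U> S f \<Longrightarrow> p \<in> \<U> \<Longrightarrow> q \<in> \<U> \<Longrightarrow> (\<And>c. c \<in> S \<Longrightarrow> p c = q c) \<Longrightarrow> f p = f q"
  unfolding depends_on_def by blast

lemma depends_on_mono: "depends_on \<U> S f \<Longrightarrow> S \<subseteq> T \<Longrightarrow> depends_on \<U> T f"
  unfolding depends_on_def by blast

lemma diff_fun_iff:
  "diff_fun \<U> Cs f \<longleftrightarrow> smooth_on \<U> f \<and> (\<exists>S\<subseteq>Cs. finite S \<and> depends_on \<U> S f)"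
  unfolding diff_fun_def depends_on_def ..

lemma depends_on_imp_pderiv_at_eq_0:
  assumes "open \<U>" "depends_on \<U> S f" "c \<notin> S" "p \<in> \<U>"
  shows "pderiv_at c f p = 0"
proof -
  have "pderiv_at c f p = deriv (\<lambda>_. f p) (p c)"
    unfolding pderiv_at_def
  proof (rule deriv_cong_ev)
    show "\<forall>\<^sub>F t in nhds (p c). f (p(c := t)) = f p"
      using eventually_upd_in[OF assms(1,4), of c]
    proof eventually_elim
      case (elim t)
      show ?case
        by (rule depends_onD[OF assms(2) elim assms(4)]) (use assms(3) in auto)
    qed
  qed simp
  then show ?thesis by simp
qed

text \<open>For \<open>c \<in> S\<close> both derivatives are taken at the same real number, of
  functions that agree near it; for \<open>c \<notin> S\<close> both vanish.\<close>

lemma depends_on_pderiv_at: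
  assumes "open \<U>" "depends_on \<U> S f"
  shows "depends_on \<U> S (pderiv_at c f)"
  unfolding depends_on_def
proof (intro ballI impI)
  fix p q assume p: "p \<in> \<U>" and q: "q \<in> \<U>" and eq: "\<forall>c\<in>S. p c = q c"
  show "pderiv_at c f p = pderiv_at c f q"
  proof (cases "c \<in> S")
    case True
    then have pq: "p c = q c" using eq by blast
    show ?thesis
      unfolding pderiv_at_def
    proof (rule deriv_cong_ev)
      show "\<forall>\<^sub>F t in nhds (p c). f (p(c := t)) = f (q(c := t))"
        using eventually_upd_in[OF assms(1) p, of c] eventually_upd_in[OF assms(1) q, of c, folded pq]
      proof eventually_elim
        case (elim t)
        show ?case
          by (rule depends_onD[OF assms(2) elim]) (use eq in auto)
      qed
    qed (fact pq)
  next
    case False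
    then show ?thesis
      using depends_on_imp_pderiv_at_eq_0[OF assms False] p q by simp
  qed
qed

lemma diff_fun_pderiv_at_eq_0:
  assumes "open \<U>" "diff_fun \<U> Cs f" "c \<notin> Cs" "p \<in> \<U>"
  shows "pderiv_at c f p = 0"
  using assms unfolding diff_fun_iff by (meson depends_on_imp_pderiv_at_eq_0 subsetD)

lemma diff_fun_mono: "diff_fun \<U> Cs f \<Longrightarrow> Cs \<subseteq> Cs' \<Longrightarrow> diff_fun \<U> Cs' f"
  unfolding diff_fun_def by (meson order_trans)

lemma point_coords_subset: "point_coords Z \<subseteq> jet_coords Z"
  unfolding point_coords_def jet_coords_def by auto

lemma jet_coords_mono: "Z \<subseteq> Z' \<Longrightarrow> jet_coords Z \<subseteq> jet_coords Z'"
  unfolding jet_coords_def by auto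

lemma Indep_in_jet_coords [simp]: "Indep i \<in> jet_coords Z"
  unfolding jet_coords_def by simp

lemma Dep_in_jet_coords [simp]: "Dep z J \<in> jet_coords Z \<longleftrightarrow> z \<in> Z"
  unfolding jet_coords_def by auto

text \<open>Links sums over all coordinates with the separate sums in \<open>total_deriv\<close> and
  \<open>prolong\<close>. As \<open>Sum_any\<close> is 0 for infinite support, the split rests on
  finiteness.\<close>

lemma Sum_any_coord:
  fixes h :: "'n::finite coord \<Rightarrow> real"
  assumes "finite {c. h c \<noteq> 0}"
  shows "Sum_any h = (\<Sum>i\<in>UNIV. h (Indep i)) + Sum_any (\<lambda>(z, J). h (Dep z J))"
proof -
  define T where "T = {zJ. h (case_prod Dep zJ) \<noteq> 0}"
  have inj: "inj_on (case_prod Dep) T" by (auto simp: inj_on_def)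
  have "finite (case_prod Dep ` T)"
    by (rule finite_subset[OF _ assms]) (auto simp: T_def)
  then have T: "finite T" using finite_imageD inj by blast
  have "Sum_any h = sum h (range Indep \<union> case_prod Dep ` T)"
  proof (rule Sum_any.expand_superset)
    show "{c. h c \<noteq> 0} \<subseteq> range Indep \<union> case_prod Dep ` T"
    proof
      fix c assume "c \<in> {c. h c \<noteq> 0}"
      then show "c \<in> range Indep \<union> case_prod Dep ` T"
        by (cases c) (auto simp: T_def image_iff)
    qed
  qed (use T in auto)
  also have "\<dots> = sum h (range Indep) + sum h (case_prod Dep ` T)"
    by (rule sum.union_disjoint) (use T in auto)
  also have "sum h (range Indep) = (\<Sum>i\<in>UNIV. h (Indep i))"
    by (subst sum.reindex) (auto simp: inj_on_def)
  also have "sum h (case_prod Dep ` T) = (\<Sum>zJ\<in>T. h (case_prod Dep zJ))"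
    by (subst sum.reindex[OF inj]) simp
  also have "\<dots> = Sum_any (\<lambda>zJ. h (case_prod Dep zJ))"
    by (rule Sum_any.expand_superset[symmetric]) (use T in \<open>auto simp: T_def\<close>)
  also have "(\<lambda>zJ. h (case_prod Dep zJ)) = (\<lambda>(z, J). h (Dep z J))"
    by (auto simp: fun_eq_iff)
  finally show ?thesis .
qed

section \<open>Derivations of the algebra of differential functions\<close>

locale jet_domain =
  fixes \<U> :: "'n::{finite,linorder} jet set" and Z :: "dep set"
  assumes open_domain: "open \<U>"
begin

abbreviation df :: "'n dfun \<Rightarrow> bool" where
  "df \<equiv> diff_fun \<U> (jet_coords Z)"

lemma df_smooth: "df f \<Longrightarrow> smooth_on \<U> f"
  unfolding diff_fun_iff by blast

lemma df_support:
  assumes "df f"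
  obtains S where "finite S" "S \<subseteq> jet_coords Z" "depends_on \<U> S f"
  using assms unfolding diff_fun_iff by blast

lemma df_cong:
  assumes "df f" "\<And>p. p \<in> \<U> \<Longrightarrow> f p = g p"
  shows "df g"
proof -
  obtain S where S: "finite S" "S \<subseteq> jet_coords Z" "depends_on \<U> S f"
    by (rule df_support[OF assms(1)])
  have "depends_on \<U> S g"
    unfolding depends_on_def
  proof (intro ballI impI)
    fix p q assume "p \<in> \<U>" "q \<in> \<U>" "\<forall>c\<in>S. p c = q c"
    then have "f p = f q" by (intro depends_onD[OF S(3)]) auto
    then show "g p = g q"
      using assms(2)[OF \<open>p \<in> \<U>\<close>] assms(2)[OF \<open>q \<in> \<U>\<close>] by simp
  qed
  moreover have "smooth_on \<U> g"
    by (rule smooth_on_cong[OF open_domain assms(2) df_smooth[OF assms(1)]])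
  ultimately show ?thesis
    unfolding diff_fun_iff using S(1,2) by blast
qed

lemma df_const: "df (\<lambda>_. a)"
  unfolding diff_fun_iff depends_on_def by (auto simp: smooth_on_const)

lemma df_coord: "c \<in> jet_coords Z \<Longrightarrow> df (\<lambda>p. p c)"
  unfolding diff_fun_iff depends_on_def by (auto simp: smooth_on_coord intro!: exI[of _ "{c}"])

lemma df_add:
  assumes "df f" "df g"
  shows "df (\<lambda>p. f p + g p)"
proof -
  obtain S where S: "finite S" "S \<subseteq> jet_coords Z" "depends_on \<U> S f"
    by (rule df_support[OF assms(1)])
  obtain T where T: "finite T" "T \<subseteq> jet_coords Z" "depends_on \<U> T g"
    by (rule df_support[OF assms(2)])
  have "depends_on \<U> (S \<union> T) (\<lambda>p. f p + g p)"
    unfolding depends_on_def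
    by (intro ballI impI arg_cong2[of _ _ _ _ "(+)"] depends_onD[OF S(3)] depends_onD[OF T(3)]) auto
  moreover have "smooth_on \<U> (\<lambda>p. f p + g p)"
    by (rule smooth_on_add[OF open_domain df_smooth[OF assms(1)] df_smooth[OF assms(2)]])
  ultimately show ?thesis
    unfolding diff_fun_iff using S T by (intro conjI exI[of _ "S \<union> T"]) auto
qed

lemma df_mult:
  assumes "df f" "df g"
  shows "df (\<lambda>p. f p * g p)"
proof -
  obtain S where S: "finite S" "S \<subseteq> jet_coords Z" "depends_on \<U> S f"
    by (rule df_support[OF assms(1)])
  obtain T where T: "finite T" "T \<subseteq> jet_coords Z" "depends_on \<U> T g"
    by (rule df_support[OF assms(2)])
  have "depends_on \<U> (S \<union> T) (\<lambda>p. f p * g p)"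
    unfolding depends_on_def
    by (intro ballI impI arg_cong2[of _ _ _ _ "(*)"] depends_onD[OF S(3)] depends_onD[OF T(3)]) auto
  moreover have "smooth_on \<U> (\<lambda>p. f p * g p)"
    by (rule smooth_on_mult[OF open_domain df_smooth[OF assms(1)] df_smooth[OF assms(2)]])
  ultimately show ?thesis
    unfolding diff_fun_iff using S T by (intro conjI exI[of _ "S \<union> T"]) auto
qed

lemma df_uminus: "df f \<Longrightarrow> df (\<lambda>p. - f p)"
  using df_mult[OF df_const[of "-1"], of f] by simp

lemma df_diff: "df f \<Longrightarrow> df g \<Longrightarrow> df (\<lambda>p. f p - g p)"
  using df_add[OF _ df_uminus, of f g] by simp

lemma df_sum:
  assumes "\<And>a. a \<in> A \<Longrightarrow> df (f a)"
  shows "df (\<lambda>p. \<Sum>a\<in>A. f a p)"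
  using assms
proof (induction A rule: infinite_finite_induct)
  case (insert a A)
  then have "df (\<lambda>p. f a p + (\<Sum>a\<in>A. f a p))"
    by (intro df_add) auto
  then show ?case using insert by simp
qed (simp_all add: df_const)

lemma df_pderiv_at:
  assumes "df f"
  shows "df (pderiv_at c f)"
proof -
  obtain S where S: "finite S" "S \<subseteq> jet_coords Z" "depends_on \<U> S f"
    by (rule df_support[OF assms])
  show ?thesis
    unfolding diff_fun_iff
    using smooth_on_pderiv_at[OF df_smooth[OF assms], of c]
      depends_on_pderiv_at[OF open_domain S(3), of c] S(1,2) by blast
qed

text \<open>Common form of total derivatives, prolongations and single partial derivatives, so that
  the derivation rules are proved once. The sum runs over all coordinates since the relevant finite
  set varies with \<open>f\<close>.\<close>

definition vector_field :: "('n coord \<Rightarrow> 'n dfun) \<Rightarrow> 'n dfun \<Rightarrow> 'n dfun" where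
  "vector_field b f p = Sum_any (\<lambda>c. b c p * pderiv_at c f p)"

text \<open>Any finite \<open>S\<close> that \<open>f\<close> depends on will do; two functions are
  therefore evaluated over the union of their sets.\<close>

lemma vector_field_eq_sum:
  assumes "finite S" "depends_on \<U> S f" "p \<in> \<U>"
  shows "vector_field b f p = (\<Sum>c\<in>S. b c p * pderiv_at c f p)"
  unfolding vector_field_def
  by (rule Sum_any.expand_superset)
     (use assms depends_on_imp_pderiv_at_eq_0[OF open_domain assms(2) _ assms(3)] in auto)

lemma vector_field_add:
  assumes "df f" "df g" "p \<in> \<U>"
  shows "vector_field b (\<lambda>q. f q + g q) p = vector_field b f p + vector_field b g p"
proof -
  obtain S where S: "finite S" "S \<subseteq> jet_coords Z" "depends_on \<U> S f"
    by (rule df_support[OF assms(1)])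
  obtain T where T: "finite T" "T \<subseteq> jet_coords Z" "depends_on \<U> T g"
    by (rule df_support[OF assms(2)])
  have f: "depends_on \<U> (S \<union> T) f" and g: "depends_on \<U> (S \<union> T) g"
    using S T by (auto intro: depends_on_mono)
  have fg: "depends_on \<U> (S \<union> T) (\<lambda>q. f q + g q)"
    unfolding depends_on_def
    by (intro ballI impI arg_cong2[of _ _ _ _ "(+)"] depends_onD[OF f] depends_onD[OF g]) auto
  have ST: "finite (S \<union> T)" using S T by simp
  show ?thesis
    unfolding vector_field_eq_sum[OF ST fg assms(3)] vector_field_eq_sum[OF ST f assms(3)]
      vector_field_eq_sum[OF ST g assms(3)]
      pderiv_at_add[OF df_smooth[OF assms(1)] df_smooth[OF assms(2)] assms(3)]
    by (simp add: algebra_simps sum.distrib)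
qed

lemma vector_field_mult:
  assumes "df f" "df g" "p \<in> \<U>"
  shows "vector_field b (\<lambda>q. f q * g q) p = vector_field b f p * g p + f p * vector_field b g p"
proof -
  obtain S where S: "finite S" "S \<subseteq> jet_coords Z" "depends_on \<U> S f"
    by (rule df_support[OF assms(1)])
  obtain T where T: "finite T" "T \<subseteq> jet_coords Z" "depends_on \<U> T g"
    by (rule df_support[OF assms(2)])
  have f: "depends_on \<U> (S \<union> T) f" and g: "depends_on \<U> (S \<union> T) g"
    using S T by (auto intro: depends_on_mono)
  have fg: "depends_on \<U> (S \<union> T) (\<lambda>q. f q * g q)"
    unfolding depends_on_def
    by (intro ballI impI arg_cong2[of _ _ _ _ "(*)"] depends_onD[OF f] depends_onD[OF g]) auto
  have ST: "finite (S \<union> T)" using S T by simp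
  show ?thesis
    unfolding vector_field_eq_sum[OF ST fg assms(3)] vector_field_eq_sum[OF ST f assms(3)]
      vector_field_eq_sum[OF ST g assms(3)]
      pderiv_at_mult[OF df_smooth[OF assms(1)] df_smooth[OF assms(2)] assms(3)]
    by (simp add: algebra_simps sum.distrib sum_distrib_left sum_distrib_right)
qed

lemma vector_field_const: "vector_field b (\<lambda>_. a) p = 0"
  unfolding vector_field_def pderiv_at_const by simp

lemma vector_field_coord: "vector_field b (\<lambda>p. p c) p = b c p"
  unfolding vector_field_def pderiv_at_coord
  by (subst Sum_any.expand_superset[of "{c}"]) auto

lemma vector_field_sum:
  assumes "\<And>a. a \<in> A \<Longrightarrow> df (f a)" "p \<in> \<U>"
  shows "vector_field b (\<lambda>q. \<Sum>a\<in>A. f a q) p = (\<Sum>a\<in>A. vector_field b (f a) p)"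
  using assms(1)
proof (induction A rule: infinite_finite_induct)
  case (insert a A)
  then have "vector_field b (\<lambda>q. f a q + (\<Sum>a\<in>A. f a q)) p
      = vector_field b (f a) p + vector_field b (\<lambda>q. \<Sum>a\<in>A. f a q) p"
    by (intro vector_field_add df_sum assms(2)) auto
  then show ?case using insert by simp
qed (simp_all add: vector_field_const)

lemma vector_field_eq_jet_sum:
  assumes "df f" "p \<in> \<U>"
  shows "vector_field b f p = (\<Sum>i\<in>UNIV. b (Indep i) p * pderiv_at (Indep i) f p)
    + Sum_any (\<lambda>(z, J). b (Dep z J) p * pderiv_at (Dep z J) f p)"
proof -
  obtain S where S: "finite S" "S \<subseteq> jet_coords Z" "depends_on \<U> S f"
    by (rule df_support[OF assms(1)])
  have "finite {c. b c p * pderiv_at c f p \<noteq> 0}"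
    by (rule finite_subset[OF _ S(1)])
       (use depends_on_imp_pderiv_at_eq_0[OF open_domain S(3) _ assms(2)] in auto)
  then show ?thesis
    unfolding vector_field_def by (rule Sum_any_coord)
qed

section \<open>Total derivatives as commuting derivations\<close>

text \<open>The values of \<open>D\<^sub>i\<close> on the coordinates, which are its coefficients as
  a vector field.\<close>

definition jet_shift :: "'n \<Rightarrow> 'n coord \<Rightarrow> 'n dfun" where
  "jet_shift i c p =
     (case c of Indep j \<Rightarrow> if i = j then 1 else 0 | Dep z J \<Rightarrow> p (Dep z (J(i := Suc (J i)))))"

lemma total_deriv_eq_vector_field:
  assumes "df f" "p \<in> \<U>"
  shows "total_deriv i f p = vector_field (jet_shift i) f p"
  unfolding vector_field_eq_jet_sum[OF assms] total_deriv_def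
  by (simp add: jet_shift_def if_distrib[of "\<lambda>x. x * _"] cong: if_cong)

lemma total_deriv_cong:
  assumes "p \<in> \<U>" "\<And>q. q \<in> \<U> \<Longrightarrow> f q = g q"
  shows "total_deriv i f p = total_deriv i g p"
  unfolding total_deriv_def by (simp only: pderiv_at_cong[OF open_domain assms])

lemma total_deriv_add:
  "df f \<Longrightarrow> df g \<Longrightarrow> p \<in> \<U> \<Longrightarrow> total_deriv i (\<lambda>q. f q + g q) p = total_deriv i f p + total_deriv i g p"
  by (simp add: total_deriv_eq_vector_field df_add vector_field_add)

lemma total_deriv_mult:
  "df f \<Longrightarrow> df g \<Longrightarrow> p \<in> \<U> \<Longrightarrow>
   total_deriv i (\<lambda>q. f q * g q) p = total_deriv i f p * g p + f p * total_deriv i g p"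
  by (simp add: total_deriv_eq_vector_field df_mult vector_field_mult)

lemma total_deriv_const: "p \<in> \<U> \<Longrightarrow> total_deriv i (\<lambda>_. a) p = 0"
  by (simp add: total_deriv_eq_vector_field df_const vector_field_const)

lemma total_deriv_cmult:
  "df f \<Longrightarrow> p \<in> \<U> \<Longrightarrow> total_deriv i (\<lambda>q. a * f q) p = a * total_deriv i f p"
  by (simp add: total_deriv_mult df_const total_deriv_const)

lemma total_deriv_uminus:
  "df f \<Longrightarrow> p \<in> \<U> \<Longrightarrow> total_deriv i (\<lambda>q. - f q) p = - total_deriv i f p"
  using total_deriv_cmult[of f p i "-1"] by simp

lemma total_deriv_diff:
  "df f \<Longrightarrow> df g \<Longrightarrow> p \<in> \<U> \<Longrightarrow> total_deriv i (\<lambda>q. f q - g q) p = total_deriv i f p - total_deriv i g p"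
  using total_deriv_add[OF _ df_uminus, of f g p i] by (simp add: total_deriv_uminus)

lemma total_deriv_sum:
  "(\<And>a. a \<in> A \<Longrightarrow> df (f a)) \<Longrightarrow> p \<in> \<U> \<Longrightarrow>
   total_deriv i (\<lambda>q. \<Sum>a\<in>A. f a q) p = (\<Sum>a\<in>A. total_deriv i (f a) p)"
  by (simp add: total_deriv_eq_vector_field df_sum vector_field_sum)

lemma total_deriv_coord:
  "c \<in> jet_coords Z \<Longrightarrow> p \<in> \<U> \<Longrightarrow> total_deriv i (\<lambda>q. q c) p = jet_shift i c p"
  by (simp add: total_deriv_eq_vector_field df_coord vector_field_coord)

lemma df_jet_shift:
  assumes "c \<in> jet_coords Z"
  shows "df (jet_shift i c)"
proof (cases c)
  case (Indep j)
  then have "jet_shift i c = (\<lambda>_. if i = j then 1 else 0)"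
    by (simp add: jet_shift_def fun_eq_iff)
  then show ?thesis by (simp only: df_const)
next
  case (Dep z J)
  then have "jet_shift i c = (\<lambda>p. p (Dep z (J(i := Suc (J i)))))"
    by (simp add: jet_shift_def fun_eq_iff)
  moreover have "df (\<lambda>p. p (Dep z (J(i := Suc (J i)))))"
    by (rule df_coord) (use assms Dep in simp)
  ultimately show ?thesis by simp
qed

lemma df_total_deriv:
  assumes "df f"
  shows "df (total_deriv i f)"
proof -
  obtain S where S: "finite S" "S \<subseteq> jet_coords Z" "depends_on \<U> S f"
    by (rule df_support[OF assms(1)])
  have "df (\<lambda>p. \<Sum>c\<in>S. jet_shift i c p * pderiv_at c f p)"
    using S(2) by (intro df_sum df_mult df_jet_shift df_pderiv_at assms) auto
  then show ?thesis
    by (rule df_cong)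
       (simp add: total_deriv_eq_vector_field[OF assms] vector_field_eq_sum[OF S(1,3)])
qed

lemma total_deriv_jet_shift_commute:
  assumes "c \<in> jet_coords Z" "p \<in> \<U>"
  shows "total_deriv i (jet_shift j c) p = total_deriv j (jet_shift i c) p"
proof (cases c)
  case (Indep k)
  then have "jet_shift i c = (\<lambda>_. if i = k then 1 else 0)" for i
    by (simp add: jet_shift_def fun_eq_iff)
  then show ?thesis by (simp only: total_deriv_const assms)
next
  case (Dep z J)
  then have *: "jet_shift i c = (\<lambda>p. p (Dep z (J(i := Suc (J i)))))" for i
    by (simp add: jet_shift_def fun_eq_iff)
  have z: "z \<in> Z" using assms Dep by simp
  have **: "total_deriv i (\<lambda>p. p (Dep z K)) p = p (Dep z (K(i := Suc (K i))))" for i K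
    using total_deriv_coord[of "Dep z K" p i] z assms(2) by (simp add: jet_shift_def)
  have "(J(j := Suc (J j)))(i := Suc ((J(j := Suc (J j))) i))
      = (J(i := Suc (J i)))(j := Suc ((J(i := Suc (J i))) j))"
    by (auto simp: fun_eq_iff)
  then show ?thesis
    unfolding * ** by (rule arg_cong)
qed

text \<open>Expanding \<open>D\<^sub>i D\<^sub>j f\<close> gives a part with first derivatives of
  \<open>f\<close>, symmetric because the index shifts commute, and a part with second derivatives,
  symmetric because mixed partial derivatives agree.\<close>

lemma total_deriv_commute:
  assumes "df f" "p \<in> \<U>"
  shows "total_deriv i (total_deriv j f) p = total_deriv j (total_deriv i f) p"
proof -
  obtain S where S: "finite S" "S \<subseteq> jet_coords Z" "depends_on \<U> S f"
    by (rule df_support[OF assms(1)])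
  have *: "total_deriv i (total_deriv j f) p =
     (\<Sum>d\<in>S. total_deriv i (jet_shift j d) p * pderiv_at d f p) +
     (\<Sum>d\<in>S. \<Sum>c\<in>S. jet_shift j d p * jet_shift i c p * pderiv_at c (pderiv_at d f) p)" for i j
  proof -
    have "total_deriv i (total_deriv j f) p = total_deriv i (\<lambda>q. \<Sum>d\<in>S. jet_shift j d q * pderiv_at d f q) p"
      by (rule total_deriv_cong[OF assms(2)])
         (simp add: total_deriv_eq_vector_field[OF assms(1)] vector_field_eq_sum[OF S(1,3)])
    also have "\<dots> = (\<Sum>d\<in>S. total_deriv i (jet_shift j d) p * pderiv_at d f p
        + jet_shift j d p * total_deriv i (pderiv_at d f) p)"
      using S(2) assms
      by (subst total_deriv_sum) (auto intro!: df_mult df_jet_shift df_pderiv_at sum.cong total_deriv_mult)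
    also have "\<dots> = (\<Sum>d\<in>S. total_deriv i (jet_shift j d) p * pderiv_at d f p) +
      (\<Sum>d\<in>S. \<Sum>c\<in>S. jet_shift j d p * jet_shift i c p * pderiv_at c (pderiv_at d f) p)"
      by (simp add: sum.distrib sum_distrib_left mult.assoc
          total_deriv_eq_vector_field[OF df_pderiv_at[OF assms(1)] assms(2)]
          vector_field_eq_sum[OF S(1) depends_on_pderiv_at[OF open_domain S(3)] assms(2)])
    finally show ?thesis .
  qed
  have "(\<Sum>d\<in>S. \<Sum>c\<in>S. jet_shift j d p * jet_shift i c p * pderiv_at c (pderiv_at d f) p)
      = (\<Sum>c\<in>S. \<Sum>d\<in>S. jet_shift i c p * jet_shift j d p * pderiv_at d (pderiv_at c f) p)"
    by (subst sum.swap, intro sum.cong refl,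
        subst pderiv_at_commute[OF open_domain df_smooth[OF assms(1)] assms(2)]) (rule refl mult.commute arg_cong2[of _ _ _ _ "(*)"])+
  moreover have "(\<Sum>d\<in>S. total_deriv i (jet_shift j d) p * pderiv_at d f p)
      = (\<Sum>d\<in>S. total_deriv j (jet_shift i d) p * pderiv_at d f p)"
  proof (rule sum.cong[OF refl])
    fix d assume "d \<in> S"
    then have "total_deriv i (jet_shift j d) p = total_deriv j (jet_shift i d) p"
      using S(2) by (intro total_deriv_jet_shift_commute assms(2)) auto
    then show "total_deriv i (jet_shift j d) p * pderiv_at d f p
        = total_deriv j (jet_shift i d) p * pderiv_at d f p"
      by (rule arg_cong)
  qed
  ultimately show ?thesis
    unfolding *[of i j] *[of j i] by (rule arg_cong2[of _ _ _ _ "(+)", rotated])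
qed

end

section \<open>Multinomial coefficients\<close>

abbreviation inc :: "'n \<Rightarrow> ('n \<Rightarrow> nat) \<Rightarrow> 'n \<Rightarrow> nat" where
  "inc i J \<equiv> J(i := Suc (J i))"

text \<open>The multi-index \<open>K + M + e\<^sub>i\<close>, spelled as in
  \<open>noether_vector\<close>.\<close>

abbreviation plus_inc :: "'n \<Rightarrow> ('n \<Rightarrow> nat) \<Rightarrow> ('n \<Rightarrow> nat) \<Rightarrow> 'n \<Rightarrow> nat" where
  "plus_inc i K M \<equiv> (\<lambda>j. K j + M j)(i := Suc (K i + M i))"

lemma finite_multiindex_box: "finite {J :: 'n::finite \<Rightarrow> nat. \<forall>j. J j \<le> s j}"
proof -
  have "{J. \<forall>j. J j \<le> s j} = PiE UNIV (\<lambda>j. {..s j})"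
    by (auto simp: PiE_def Pi_def extensional_def)
  then show ?thesis by (simp add: finite_PiE)
qed

lemma order_of_inc: "order_of (inc i J) = Suc (order_of J)"
proof -
  have "(\<Sum>j\<in>UNIV. inc i J j) = (\<Sum>j\<in>UNIV. J j + (if j = i then 1 else 0))"
    by (rule sum.cong) auto
  then show ?thesis
    unfolding order_of_def by (simp add: sum.distrib)
qed

lemma order_of_0: "order_of (\<lambda>_. 0) = 0"
  by (simp add: order_of_def)

lemma multinom_0: "multinom (\<lambda>_. 0) = 1"
  by (simp add: multinom_def order_of_0)

lemma multinom_nonzero: "multinom J \<noteq> 0"
  by (simp add: multinom_def)

text \<open>The right-hand side mentions only \<open>A = inc i J\<close>, so it expresses
  \<open>multinom (A - e\<^sub>i)\<close> as \<open>(|A| - 1)! A\<^sub>i / A!\<close>.\<close>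

lemma multinom_inc:
  "multinom J = fact (order_of (inc i J) - 1) * real (inc i J i) / (\<Prod>j\<in>UNIV. fact (inc i J j))"
proof -
  have "(\<Prod>j\<in>UNIV. fact (inc i J j)) = (fact (Suc (J i)) :: real) * (\<Prod>j\<in>UNIV - {i}. fact (inc i J j))"
    by (subst prod.remove[of _ i]) auto
  also have "(\<Prod>j\<in>UNIV - {i}. fact (inc i J j)) = ((\<Prod>j\<in>UNIV - {i}. fact (J j)) :: real)"
    by (rule prod.cong) auto
  also have "fact (Suc (J i)) * (\<Prod>j\<in>UNIV - {i}. fact (J j)) = real (Suc (J i)) * (\<Prod>j\<in>UNIV. fact (J j))"
    by (subst prod.remove[of UNIV i]) (auto simp: algebra_simps)
  finally show ?thesis
    by (simp only: order_of_inc multinom_def) (simp add: divide_simps del: of_nat_Suc)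
qed

lemma inc_dec: "A i > 0 \<Longrightarrow> inc i (A(i := A i - 1)) = A"
  by auto

text \<open>Pascal's rule: words with content \<open>A\<close> are sorted by one end letter. For
  \<open>A = 0\<close> the sum is empty although \<open>multinom A\<close> is 1, and this exception
  produces the boundary terms of the telescoping sum below.\<close>

lemma sum_multinom_dec:
  assumes "A \<noteq> (\<lambda>_. 0)"
  shows "(\<Sum>i | A i > 0. multinom (A(i := A i - 1))) = multinom A"
proof -
  have "(\<Sum>i | A i > 0. multinom (A(i := A i - 1)))
      = (\<Sum>i | A i > 0. fact (order_of A - 1) * real (A i) / (\<Prod>j\<in>UNIV. fact (A j)))"
  proof (rule sum.cong[OF refl])
    fix i assume "i \<in> {i. A i > 0}"
    then have "inc i (A(i := A i - 1)) = A" by (intro inc_dec) simp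
    then show "multinom (A(i := A i - 1)) = fact (order_of A - 1) * real (A i) / (\<Prod>j\<in>UNIV. fact (A j))"
      using multinom_inc[of "A(i := A i - 1)" i] by (simp only:)
  qed
  also have "\<dots> = fact (order_of A - 1) * real (\<Sum>i | A i > 0. A i) / (\<Prod>j\<in>UNIV. fact (A j))"
    by (simp add: sum_distrib_left sum_divide_distrib)
  also have "(\<Sum>i | A i > 0. A i) = order_of A"
    unfolding order_of_def by (rule sum.mono_neutral_left) auto
  also have "fact (order_of A - 1) * real (order_of A) = fact (order_of A)"
  proof -
    have "order_of A \<noteq> 0" using assms by (simp add: order_of_def fun_eq_iff)
    then show ?thesis by (simp add: fact_reduce)
  qed
  finally show ?thesis by (simp only: multinom_def[of A])
qed

lemma finite_splittings: "finite {(A, B). \<forall>j. A j + B j = (J :: 'n::finite \<Rightarrow> nat) j}"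
  by (rule finite_subset[OF _ finite_cartesian_product[OF finite_multiindex_box[of J] finite_multiindex_box[of J]]])
     (auto, metis le_add1, metis le_add2)

text \<open>For fixed \<open>i\<close>, the map from \<open>(K, M)\<close> to
  \<open>(inc i K, M)\<close> is a bijection onto the splittings \<open>(A, B)\<close> of
  \<open>J\<close> with \<open>A i > 0\<close>. Summing over \<open>i\<close> inside then collects
  the weights by Pascal's rule, with the exception at \<open>A = 0\<close>.\<close>

lemma sum_multinom_inc_left:
  fixes T :: "('n::finite \<Rightarrow> nat) \<Rightarrow> ('n \<Rightarrow> nat) \<Rightarrow> real"
  shows "(\<Sum>i\<in>UNIV. \<Sum>(K, M) | plus_inc i K M = J. multinom K * multinom M * T (inc i K) M)
    = (\<Sum>(A, B) | \<forall>j. A j + B j = J j. (if A = (\<lambda>_. 0) then 0 else multinom A) * multinom B * T A B)"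
proof -
  let ?Q = "{(A, B). \<forall>j. A j + B j = J j}"
  have "(\<Sum>(K, M) | plus_inc i K M = J. multinom K * multinom M * T (inc i K) M)
      = (\<Sum>(A, B) | (A, B) \<in> ?Q \<and> A i > 0. multinom (A(i := A i - 1)) * multinom B * T A B)" for i
  proof (rule sum.reindex_bij_witness[where i = "\<lambda>(A, B). (A(i := A i - 1), B)"
        and j = "\<lambda>(K, M). (inc i K, M)"], goal_cases)
    case (1 x)
    then show ?case by auto
  next
    case (2 x)
    then show ?case by (auto simp: fun_eq_iff) metis+
  next
    case (3 x)
    then show ?case by auto
  next
    case (4 x)
    then show ?case by (auto simp: fun_eq_iff)
  next
    case (5 x)
    then show ?case by (auto simp: fun_upd_idem)
  qed
  moreover have "{(A, B). (A, B) \<in> ?Q \<and> A i > 0} = {x \<in> ?Q. fst x i > 0}" for i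
    by auto
  ultimately have "(\<Sum>i\<in>UNIV. \<Sum>(K, M) | plus_inc i K M = J. multinom K * multinom M * T (inc i K) M)
    = (\<Sum>i\<in>UNIV. \<Sum>x\<in>{x\<in>?Q. fst x i > 0}.
      multinom ((fst x)(i := fst x i - 1)) * multinom (snd x) * T (fst x) (snd x))"
    by (simp only: case_prod_unfold)
  also have "\<dots> = (\<Sum>x\<in>?Q. \<Sum>i\<in>{i\<in>UNIV. fst x i > 0}.
      multinom ((fst x)(i := fst x i - 1)) * multinom (snd x) * T (fst x) (snd x))"
    by (rule sum.swap_restrict[OF finite finite_splittings])
  also have "\<dots> = (\<Sum>x\<in>?Q. (if fst x = (\<lambda>_. 0) then 0 else multinom (fst x)) * multinom (snd x) * T (fst x) (snd x))"
  proof (rule sum.cong[OF refl])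
    fix x :: "('n \<Rightarrow> nat) \<times> ('n \<Rightarrow> nat)"
    show "(\<Sum>i\<in>{i\<in>UNIV. fst x i > 0}. multinom ((fst x)(i := fst x i - 1)) * multinom (snd x) * T (fst x) (snd x))
        = (if fst x = (\<lambda>_. 0) then 0 else multinom (fst x)) * multinom (snd x) * T (fst x) (snd x)"
      using sum_multinom_dec[of "fst x"] by (simp add: sum_distrib_right[symmetric])
  qed
  finally show ?thesis by (simp add: case_prod_unfold)
qed

lemma sum_multinom_inc_right:
  fixes T :: "('n::finite \<Rightarrow> nat) \<Rightarrow> ('n \<Rightarrow> nat) \<Rightarrow> real"
  shows "(\<Sum>i\<in>UNIV. \<Sum>(K, M) | plus_inc i K M = J. multinom K * multinom M * T K (inc i M))
    = (\<Sum>(A, B) | \<forall>j. A j + B j = J j. multinom A * (if B = (\<lambda>_. 0) then 0 else multinom B) * T A B)"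
proof -
  have "(\<Sum>(K, M) | plus_inc i K M = J. multinom K * multinom M * T K (inc i M))
      = (\<Sum>(K, M) | plus_inc i K M = J. multinom K * multinom M * T M (inc i K))" for i
    by (rule sum.reindex_bij_witness[where i = prod.swap and j = prod.swap]) (auto simp: add.commute)
  then have "(\<Sum>i\<in>UNIV. \<Sum>(K, M) | plus_inc i K M = J. multinom K * multinom M * T K (inc i M))
      = (\<Sum>(A, B) | \<forall>j. A j + B j = J j. (if A = (\<lambda>_. 0) then 0 else multinom A) * multinom B * T B A)"
    using sum_multinom_inc_left[where J = J and T = "\<lambda>A B. T B A"] by simp
  also have "\<dots> = (\<Sum>(A, B) | \<forall>j. A j + B j = J j. multinom A * (if B = (\<lambda>_. 0) then 0 else multinom B) * T A B)"
    by (rule sum.reindex_bij_witness[where i = prod.swap and j = prod.swap]) (auto simp: add.commute)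
  finally show ?thesis .
qed

text \<open>Each \<open>(i, K, M)\<close> is an edge between the splittings
  \<open>(inc i K, M)\<close> and \<open>(K, inc i M)\<close> of \<open>J\<close>. At a splitting
  \<open>(A, B)\<close> with both parts nonzero, the edges of either kind have total weight
  \<open>multinom A * multinom B\<close>, so the contributions cancel. Only the ends
  \<open>(J, 0)\<close> and \<open>(0, J)\<close> have edges of a single kind.\<close>

lemma sum_multinom_telescope:
  fixes T :: "('n::finite \<Rightarrow> nat) \<Rightarrow> ('n \<Rightarrow> nat) \<Rightarrow> real"
  shows "(\<Sum>i\<in>UNIV. \<Sum>(K, M) | plus_inc i K M = J. multinom K * multinom M * (T (inc i K) M - T K (inc i M)))
    = multinom J * (T J (\<lambda>_. 0) - T (\<lambda>_. 0) J)"
proof -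
  let ?Q = "{(A, B). \<forall>j. A j + B j = J j}"
  \<comment> \<open>One part of a splitting determines the other, so the exceptions at 0 single out
    one splitting each.\<close>
  have zero: "A = (\<lambda>_. 0) \<longleftrightarrow> (A, B) = ((\<lambda>_. 0), J)" "B = (\<lambda>_. 0) \<longleftrightarrow> (A, B) = (J, (\<lambda>_. 0))"
    if "(A, B) \<in> ?Q" for A B
    using that by (auto simp: fun_eq_iff)
  have "(\<Sum>i\<in>UNIV. \<Sum>(K, M) | plus_inc i K M = J. multinom K * multinom M * (T (inc i K) M - T K (inc i M)))
     = (\<Sum>(A, B)\<in>?Q. (if A = (\<lambda>_. 0) then 0 else multinom A) * multinom B * T A B)
       - (\<Sum>(A, B)\<in>?Q. multinom A * (if B = (\<lambda>_. 0) then 0 else multinom B) * T A B)"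
    unfolding sum_multinom_inc_left[symmetric] sum_multinom_inc_right[symmetric]
    by (simp add: sum_subtractf[symmetric] right_diff_distrib case_prod_unfold)
  also have "\<dots> = (\<Sum>x\<in>?Q. (if x = (J, (\<lambda>_. 0)) then multinom J * T J (\<lambda>_. 0) else 0)
       - (if x = ((\<lambda>_. 0), J) then multinom J * T (\<lambda>_. 0) J else 0))"
    unfolding sum_subtractf[symmetric]
  proof (rule sum.cong[OF refl])
    fix x assume x: "x \<in> ?Q"
    obtain A B where AB: "x = (A, B)" by (cases x)
    show "(case x of (A, B) \<Rightarrow> (if A = (\<lambda>_. 0) then 0 else multinom A) * multinom B * T A B)
        - (case x of (A, B) \<Rightarrow> multinom A * (if B = (\<lambda>_. 0) then 0 else multinom B) * T A B)
      = (if x = (J, (\<lambda>_. 0)) then multinom J * T J (\<lambda>_. 0) else 0)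
       - (if x = ((\<lambda>_. 0), J) then multinom J * T (\<lambda>_. 0) J else 0)"
      unfolding AB zero(1)[OF x[unfolded AB], symmetric] zero(2)[OF x[unfolded AB], symmetric]
      using zero[OF x[unfolded AB]] by (auto simp: multinom_0)
  qed
  also have "\<dots> = multinom J * T J (\<lambda>_. 0) - multinom J * T (\<lambda>_. 0) J"
    unfolding sum_subtractf by (simp add: sum.delta finite_splittings)
  finally show ?thesis by (simp add: right_diff_distrib)
qed

section \<open>Iterated total derivatives\<close>

context jet_domain
begin

lemma df_total_derivs: "df f \<Longrightarrow> df (foldr total_deriv I f)"
  by (induction I) (simp_all add: df_total_deriv)

lemma total_derivs_eq_0:
  assumes "\<And>q. q \<in> \<U> \<Longrightarrow> f q = 0" "p \<in> \<U>"
  shows "foldr total_deriv I f p = 0"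
  using assms(2)
proof (induction I arbitrary: p)
  case (Cons i I)
  have "total_deriv i (foldr total_deriv I f) p = total_deriv i (\<lambda>_. 0) p"
    by (rule total_deriv_cong[OF Cons.prems]) (rule Cons.IH)
  then show ?case
    using total_deriv_const[OF Cons.prems] by simp
qed (simp add: assms(1))

lemma total_derivs_commute:
  assumes "df f" "p \<in> \<U>"
  shows "total_deriv i (foldr total_deriv I f) p = foldr total_deriv I (total_deriv i f) p"
  using assms(2)
proof (induction I arbitrary: p)
  case (Cons j I)
  have "total_deriv i (total_deriv j (foldr total_deriv I f)) p
      = total_deriv j (total_deriv i (foldr total_deriv I f)) p"
    by (rule total_deriv_commute[OF df_total_derivs[OF assms(1)] Cons.prems])
  also have "\<dots> = total_deriv j (foldr total_deriv I (total_deriv i f)) p"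
    by (rule total_deriv_cong[OF Cons.prems]) (rule Cons.IH)
  finally show ?case by simp
qed simp

text \<open>Commuting total derivatives can be reordered: the head of \<open>I\<close> is located in
  \<open>I'\<close> and moved to the front. This compares \<open>i # index_list J\<close> with the
  sorted list for \<open>inc i J\<close>.\<close>

lemma total_derivs_mset_cong:
  assumes "df f" "mset I = mset I'" "p \<in> \<U>"
  shows "foldr total_deriv I f p = foldr total_deriv I' f p"
  using assms(2,3)
proof (induction I arbitrary: I' p)
  case (Cons i I)
  have "i \<in> set I'"
    using Cons.prems(1) by (metis list.set_intros(1) set_mset_mset)
  then obtain ys zs where I': "I' = ys @ i # zs"
    by (meson split_list)
  have "foldr total_deriv (i # I) f p = total_deriv i (foldr total_deriv (ys @ zs) f) p"
    unfolding foldr.simps comp_apply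
  proof (rule total_deriv_cong[OF Cons.prems(2)])
    show "foldr total_deriv I f q = foldr total_deriv (ys @ zs) f q" if "q \<in> \<U>" for q
      using that Cons.prems(1) I' by (intro Cons.IH) auto
  qed
  also have "\<dots> = foldr total_deriv ys (total_deriv i (foldr total_deriv zs f)) p"
    unfolding foldr_append
    by (rule total_derivs_commute[OF df_total_derivs[OF assms(1)] Cons.prems(2)])
  finally show ?case by (simp add: I')
qed simp

text \<open>Flattens a multi-index into the list of single differentiations, so that facts on
  \<open>foldr total_deriv\<close> cover \<open>total_deriv_multi\<close>.\<close>

definition index_list :: "('n \<Rightarrow> nat) \<Rightarrow> 'n list" where
  "index_list J = concat (map (\<lambda>i. replicate (J i) i) (sorted_list_of_set UNIV))"

lemma count_index_list: "count (mset (index_list J)) i = J i"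
proof -
  have "count (mset (concat (map (\<lambda>i. replicate (J i) i) is))) i = (if i \<in> set is then J i else 0)"
    if "distinct is" for "is"
    using that by (induction "is") (auto simp: count_mset)
  then show ?thesis
    unfolding index_list_def by simp
qed

lemma total_deriv_multi_eq_foldr: "total_deriv_multi J f = foldr total_deriv (index_list J) f"
proof -
  have "foldr total_deriv (replicate k i) f = (total_deriv i ^^ k) f" for k i and f :: "'n dfun"
    by (induction k) simp_all
  then have "foldr (\<lambda>i. total_deriv i ^^ J i) is f
      = foldr total_deriv (concat (map (\<lambda>i. replicate (J i) i) is)) f" for "is" and f :: "'n dfun"
    by (induction "is") simp_all
  then show ?thesis
    unfolding total_deriv_multi_def index_list_def .
qed

lemma df_total_deriv_multi: "df f \<Longrightarrow> df (total_deriv_multi J f)"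
  unfolding total_deriv_multi_eq_foldr by (rule df_total_derivs)

lemma total_deriv_multi_eq_0:
  "(\<And>q. q \<in> \<U> \<Longrightarrow> f q = 0) \<Longrightarrow> p \<in> \<U> \<Longrightarrow> total_deriv_multi J f p = 0"
  unfolding total_deriv_multi_eq_foldr by (rule total_derivs_eq_0)

lemma total_deriv_multi_0: "total_deriv_multi (\<lambda>_. 0) f = (f :: 'n dfun)"
proof -
  have "mset (index_list (\<lambda>_. 0)) = {#}"
    by (rule multiset_eqI) (simp add: count_index_list)
  then show ?thesis
    by (simp add: total_deriv_multi_eq_foldr)
qed

lemma total_deriv_total_deriv_multi:
  assumes "df f" "p \<in> \<U>"
  shows "total_deriv i (total_deriv_multi J f) p = total_deriv_multi (inc i J) f p"
proof -
  have "foldr total_deriv (i # index_list J) f p = foldr total_deriv (index_list (inc i J)) f p"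
    by (rule total_derivs_mset_cong[OF assms(1) _ assms(2)])
       (rule multiset_eqI, simp only: mset.simps count_add_mset count_index_list, simp)
  then show ?thesis
    unfolding total_deriv_multi_eq_foldr by simp
qed

section \<open>Prolongation\<close>

lemma df_characteristic:
  assumes "\<And>i. df (\<xi> i)" "df (\<zeta> z)" "z \<in> Z"
  shows "df (characteristic \<xi> \<zeta> z)"
  unfolding characteristic_def[abs_def]
  using assms by (intro df_diff df_sum df_mult df_coord) auto

text \<open>The value of the prolonged operator on a coordinate: \<open>\<xi>\<^sup>j\<close> on
  \<open>x\<^sup>j\<close>, and \<open>\<Sum>\<^sub>i \<xi>\<^sup>i z\<^sub>J\<^sub>i + D\<^sub>J
  W\<^sup>z\<close> on \<open>z\<^sub>J\<close>.\<close>

definition prolong_coeff :: "('n \<Rightarrow> 'n dfun) \<Rightarrow> (dep \<Rightarrow> 'n dfun) \<Rightarrow> 'n coord \<Rightarrow> 'n dfun" where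
  "prolong_coeff \<xi> \<zeta> c p = (\<Sum>i\<in>UNIV. \<xi> i p * jet_shift i c p)
     + (case c of Indep i \<Rightarrow> 0 | Dep z J \<Rightarrow> total_deriv_multi J (characteristic \<xi> \<zeta> z) p)"

lemma prolong_eq_vector_field:
  assumes "df f" "p \<in> \<U>"
  shows "prolong \<xi> \<zeta> f p = vector_field (prolong_coeff \<xi> \<zeta>) f p"
proof -
  obtain S where S: "finite S" "S \<subseteq> jet_coords Z" "depends_on \<U> S f"
    by (rule df_support[OF assms(1)])
  define b where "b c p = (case c of Indep i \<Rightarrow> 0 | Dep z J \<Rightarrow> total_deriv_multi J (characteristic \<xi> \<zeta> z) p)"
    for c p
  have "prolong \<xi> \<zeta> f p = (\<Sum>i\<in>UNIV. \<xi> i p * vector_field (jet_shift i) f p) + vector_field b f p"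
    unfolding prolong_def vector_field_eq_jet_sum[OF assms, of b] total_deriv_eq_vector_field[OF assms]
    by (simp add: b_def)
  also have "\<dots> = (\<Sum>c\<in>S. prolong_coeff \<xi> \<zeta> c p * pderiv_at c f p)"
    unfolding vector_field_eq_sum[OF S(1,3) assms(2)] prolong_coeff_def b_def[symmetric]
    by (simp add: sum_distrib_left sum_distrib_right distrib_right sum.distrib mult.assoc)
       (rule sum.swap)
  finally show ?thesis
    unfolding vector_field_eq_sum[OF S(1,3) assms(2)] .
qed

text \<open>The first-order terms of the characteristic cancel those of
  \<open>\<xi>\<^sup>i D\<^sub>i\<close>. Order 0 suffices for the adjoint variables, which enter
  the Lagrangian without derivatives.\<close>

lemma prolong_coeff_order_0: "prolong_coeff \<xi> \<zeta> (Dep z (\<lambda>_. 0)) p = \<zeta> z p"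
  by (simp add: prolong_coeff_def jet_shift_def total_deriv_multi_0 characteristic_def)

section \<open>Divergences\<close>

definition is_divergence :: "'n dfun \<Rightarrow> bool" where
  "is_divergence h \<longleftrightarrow> (\<exists>B. (\<forall>i. df (B i)) \<and> (\<forall>p\<in>\<U>. h p = divergence B p))"

lemma is_divergence_cong:
  "is_divergence h \<Longrightarrow> (\<And>p. p \<in> \<U> \<Longrightarrow> h p = h' p) \<Longrightarrow> is_divergence h'"
  unfolding is_divergence_def by simp

lemma is_divergence_0: "is_divergence (\<lambda>_. 0)"
  unfolding is_divergence_def
  by (rule exI[of _ "\<lambda>_ _. 0"]) (simp add: df_const divergence_def total_deriv_const)

lemma is_divergence_diff:
  assumes "is_divergence g" "is_divergence h"
  shows "is_divergence (\<lambda>p. g p - h p)"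
proof -
  obtain A B where A: "\<And>i. df (A i)" "\<And>p. p \<in> \<U> \<Longrightarrow> g p = divergence A p"
    and B: "\<And>i. df (B i)" "\<And>p. p \<in> \<U> \<Longrightarrow> h p = divergence B p"
    using assms unfolding is_divergence_def by blast
  have "divergence (\<lambda>i q. A i q - B i q) p = g p - h p" if "p \<in> \<U>" for p
    unfolding divergence_def A(2)[OF that] B(2)[OF that]
    by (simp add: total_deriv_diff A(1) B(1) that sum_subtractf)
  then show ?thesis
    unfolding is_divergence_def
    by (intro exI[of _ "\<lambda>i q. A i q - B i q"]) (simp add: df_diff A(1) B(1))
qed

lemma is_divergence_sum:
  assumes "\<And>a. a \<in> A \<Longrightarrow> is_divergence (h a)"
  shows "is_divergence (\<lambda>p. \<Sum>a\<in>A. h a p)"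
  using assms
proof (induction A rule: infinite_finite_induct)
  case (insert a A)
  \<comment> \<open>Addition is written with two differences, for which closure is already
    proved.\<close>
  have "is_divergence (\<lambda>p. (\<Sum>a\<in>A. h a p) - (0 - h a p))"
    by (intro is_divergence_diff is_divergence_0) (use insert in auto)
  then show ?case
    by (rule is_divergence_cong) (use insert in simp)
qed (simp_all add: is_divergence_0)

lemma is_divergence_total_deriv:
  assumes "df f"
  shows "is_divergence (total_deriv i f)"
  unfolding is_divergence_def
proof (intro exI conjI allI ballI)
  let ?B = "\<lambda>j. if j = i then f else (\<lambda>_. 0)"
  show "df (?B j)" for j
    using assms df_const[of 0] by simp
  fix p assume p: "p \<in> \<U>"
  have "divergence ?B p = (\<Sum>j\<in>UNIV. if j = i then total_deriv i f p else 0)"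
    unfolding divergence_def by (rule sum.cong) (auto simp: total_deriv_const p)
  then show "total_deriv i f p = divergence ?B p"
    by simp
qed

text \<open>Since total derivatives commute, the adjoint of \<open>D\<^sub>I\<close> is \<open>\<plusminus>D\<^sub>I\<close> with the indices in the same
  order.\<close>

lemma is_divergence_adjoint:
  assumes "df f" "df g"
  shows "is_divergence (\<lambda>p. g p * foldr total_deriv I f p
    - (-1) ^ length I * f p * foldr total_deriv I g p)"
  using assms(2)
proof (induction I arbitrary: g)
  case Nil
  show ?case by (rule is_divergence_cong[OF is_divergence_0]) simp
next
  case (Cons i I)
  let ?f = "foldr total_deriv I f"
  \<comment> \<open>The outer \<open>D\<^sub>i\<close> is moved to \<open>g\<close> by the product
    rule, and the induction hypothesis for \<open>D\<^sub>i g\<close> in place of \<open>g\<close>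
    treats the remaining product. This puts \<open>i\<close> innermost; commutation brings it back
    to the front.\<close>
  have "is_divergence (\<lambda>p. total_deriv i (\<lambda>q. g q * ?f q) p -
     (total_deriv i g p * ?f p - (-1) ^ length I * f p * foldr total_deriv I (total_deriv i g) p))"
    by (intro is_divergence_diff is_divergence_total_deriv Cons.IH df_mult df_total_deriv
        df_total_derivs assms(1) Cons.prems)
  then show ?case
  proof (rule is_divergence_cong)
    fix p assume p: "p \<in> \<U>"
    show "total_deriv i (\<lambda>q. g q * ?f q) p -
        (total_deriv i g p * ?f p - (-1) ^ length I * f p * foldr total_deriv I (total_deriv i g) p)
      = g p * foldr total_deriv (i # I) f p
        - (-1) ^ length (i # I) * f p * foldr total_deriv (i # I) g p"
      by (simp add: total_deriv_mult[OF Cons.prems df_total_derivs[OF assms(1)] p]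
          total_derivs_commute[OF Cons.prems p])
  qed
qed

section \<open>The Noether identity\<close>

text \<open>Both sums over multi-indices of a total divergence are regrouped by the multi-index \<open>J\<close> of
  \<open>\<partial>L / \<partial>z\<^sub>J\<close>; for each \<open>J\<close> they telescope, because the multinomial coefficients satisfy Pascal's
  rule.\<close>

lemma noether_identity:
  assumes W: "df W" and l: "\<And>J. df (l J)" and p: "p \<in> \<U>"
    and bound: "\<And>J q. q \<in> \<U> \<Longrightarrow> \<not> (\<forall>j. J j \<le> s j) \<Longrightarrow> l J q = 0"
  shows "(\<Sum>i\<in>UNIV. total_deriv i (\<lambda>q. \<Sum>K\<in>{K. (\<forall>j. K j \<le> s j) \<and> K i < s i}.
       total_deriv_multi K W q * (\<Sum>M\<in>{M. \<forall>j. M j \<le> s j - K j}.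
         noether_weight i K M * ((-1) ^ order_of M * total_deriv_multi M (l (plus_inc i K M)) q))) p)
    = (\<Sum>J | \<forall>j. J j \<le> s j. total_deriv_multi J W p * l J p)
      - W p * (\<Sum>J | \<forall>j. J j \<le> s j. (-1) ^ order_of J * total_deriv_multi J (l J) p)"
proof -
  let ?Box = "{J. \<forall>j. J j \<le> s j}"
  \<comment> \<open>\<open>A\<close> derivatives on \<open>W\<close>, \<open>B\<close> on
    \<open>l J\<close>. Because of the sign, one application of the product rule yields a difference
    of two such terms.\<close>
  define T where "T J A B = (-1) ^ order_of B * total_deriv_multi A W p * total_deriv_multi B (l J) p"
    for J A B
  have T_0: "T J A B = 0" if "J \<notin> ?Box" for J A B
    using total_deriv_multi_eq_0[OF bound[of _ J] p] that by (simp add: T_def)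
  define h where "h i = (\<lambda>(K, M). noether_weight i K M *
     (T (plus_inc i K M) (inc i K) M - T (plus_inc i K M) K (inc i M)))" for i
  let ?K = "\<lambda>i. {K. (\<forall>j. K j \<le> s j) \<and> K i < s i}"
  let ?M = "\<lambda>K. {M. \<forall>j. M j \<le> s j - K j}"
  have fin: "finite (?K i)" "finite (?M K)" for i K
    by (auto intro: finite_subset[OF _ finite_multiindex_box[of s]] finite_multiindex_box)
  \<comment> \<open>The range of \<open>M\<close> allows \<open>K i + M i = s i\<close>, and then
    \<open>plus_inc i K M\<close> exceeds the bound by one in direction \<open>i\<close>.
    \<open>?P\<close> omits these pairs; their summands vanish with \<open>l\<close>.\<close>
  let ?P = "\<lambda>i. {x. plus_inc i (fst x) (snd x) \<in> ?Box}"
  have P_sub: "?P i \<subseteq> Sigma (?K i) ?M" for i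
  proof
    fix x assume "x \<in> ?P i"
    then have *: "plus_inc i (fst x) (snd x) j \<le> s j" for j
      by blast
    have "fst x j + snd x j \<le> s j" for j
      using *[of j] by (cases "j = i") auto
    then have "fst x j \<le> s j" "snd x j \<le> s j - fst x j" for j
      by (meson add_leD1, metis add.commute le_diff_conv2 add_leD1)
    moreover have "fst x i < s i"
      using *[of i] by simp
    ultimately show "x \<in> Sigma (?K i) ?M"
      by (cases x) auto
  qed
  have finP: "finite (?P i)" for i
    by (rule finite_subset[OF P_sub]) (use fin in auto)
  let ?N = "\<lambda>i q. \<Sum>K\<in>?K i. total_deriv_multi K W q * (\<Sum>M\<in>?M K.
         noether_weight i K M * ((-1) ^ order_of M * total_deriv_multi M (l (plus_inc i K M)) q))"
  have "total_deriv i (?N i) p = (\<Sum>K\<in>?K i. \<Sum>M\<in>?M K. h i (K, M))" for i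
  proof -
    have "total_deriv i (?N i) p
      = (\<Sum>K\<in>?K i. total_deriv_multi (inc i K) W p * (\<Sum>M\<in>?M K.
         noether_weight i K M * ((-1) ^ order_of M * total_deriv_multi M (l (plus_inc i K M)) p))
        + total_deriv_multi K W p * (\<Sum>M\<in>?M K.
         noether_weight i K M * ((-1) ^ order_of M * total_deriv_multi (inc i M) (l (plus_inc i K M)) p)))"
      by (simp add: total_deriv_sum total_deriv_mult total_deriv_cmult df_sum df_mult df_const
          df_total_deriv_multi W l p total_deriv_total_deriv_multi total_deriv_const
          del: fun_upd_apply)
    also have "\<dots> = (\<Sum>K\<in>?K i. \<Sum>M\<in>?M K. h i (K, M))"
      unfolding h_def T_def prod.case order_of_inc
      by (simp add: sum_distrib_left sum.distrib[symmetric] algebra_simps del: fun_upd_apply)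
    finally show ?thesis .
  qed
  also have "(\<Sum>K\<in>?K i. \<Sum>M\<in>?M K. h i (K, M)) = sum (h i) (Sigma (?K i) ?M)" for i
    by (subst sum.Sigma) (use fin in auto)
  also have "sum (h i) (Sigma (?K i) ?M) = sum (h i) (?P i)" for i
  proof (rule sum.mono_neutral_right[OF _ P_sub])
    show "finite (Sigma (?K i) ?M)" by (use fin in auto)
    show "\<forall>x\<in>Sigma (?K i) ?M - ?P i. h i x = 0"
    proof
      fix x assume "x \<in> Sigma (?K i) ?M - ?P i"
      then have "plus_inc i (fst x) (snd x) \<notin> ?Box" by blast
      then show "h i x = 0"
        unfolding h_def case_prod_unfold T_0[OF \<open>plus_inc i (fst x) (snd x) \<notin> ?Box\<close>]
        by (simp only: diff_self mult_zero_right)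
    qed
  qed
  also have "sum (h i) (?P i) = (\<Sum>J\<in>?Box. \<Sum>x\<in>{x\<in>?P i. plus_inc i (fst x) (snd x) = J}. h i x)" for i
    by (rule sum.group[symmetric]) (use finP finite_multiindex_box in auto)
  finally have regroup: "total_deriv i (?N i) p
      = (\<Sum>J\<in>?Box. \<Sum>x\<in>{x\<in>?P i. plus_inc i (fst x) (snd x) = J}. h i x)" for i .
  \<comment> \<open>On the pairs belonging to one \<open>J\<close> the denominator of the weight is
    the constant \<open>multinom J\<close>.\<close>
  have fibre: "(\<Sum>x\<in>{x\<in>?P i. plus_inc i (fst x) (snd x) = J}. h i x)
      = (\<Sum>(K, M) | plus_inc i K M = J. multinom K * multinom M * (T J (inc i K) M - T J K (inc i M))) / multinom J"
    if "J \<in> ?Box" for i J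
    unfolding sum_divide_distrib
  proof (rule sum.cong)
    show "{x \<in> ?P i. plus_inc i (fst x) (snd x) = J} = {(K, M). plus_inc i K M = J}"
      using that unfolding case_prod_unfold by blast
    fix x assume "x \<in> {(K, M). plus_inc i K M = J}"
    then obtain K M where x: "x = (K, M)" and J: "plus_inc i K M = J" by blast
    show "h i x = (case x of (K, M) \<Rightarrow> multinom K * multinom M * (T J (inc i K) M - T J K (inc i M))) / multinom J"
      unfolding x h_def prod.case noether_weight_def J by simp
  qed
  have "(\<Sum>i\<in>UNIV. total_deriv i (?N i) p)
     = (\<Sum>i\<in>UNIV. \<Sum>J\<in>?Box. (\<Sum>(K, M) | plus_inc i K M = J.
          multinom K * multinom M * (T J (inc i K) M - T J K (inc i M))) / multinom J)"
    unfolding regroup by (intro sum.cong refl fibre)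
  also have "\<dots> = (\<Sum>J\<in>?Box. \<Sum>i\<in>UNIV. (\<Sum>(K, M) | plus_inc i K M = J.
          multinom K * multinom M * (T J (inc i K) M - T J K (inc i M))) / multinom J)"
    by (rule sum.swap)
  also have "\<dots> = (\<Sum>J\<in>?Box. T J J (\<lambda>_. 0) - T J (\<lambda>_. 0) J)"
    unfolding sum_divide_distrib[symmetric] sum_multinom_telescope by (simp add: multinom_nonzero)
  finally show ?thesis
    by (simp add: T_def total_deriv_multi_0 order_of_0 sum_subtractf sum_distrib_left algebra_simps)
qed

end

section \<open>Orders of the occurring derivatives and the divergence of the Noether vector\<close>

context jet_domain
begin

text \<open>A coordinate vector field, to which the derivation rules apply.\<close>

lemma pderiv_at_eq_vector_field:
  "pderiv_at c f p = vector_field (\<lambda>d _. if d = c then 1 else 0) f p"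
  unfolding vector_field_def by (subst Sum_any.expand_superset[of "{c}"]) auto

lemma var_deriv_order_0:
  assumes "\<And>J q. q \<in> \<U> \<Longrightarrow> J \<noteq> (\<lambda>_. 0) \<Longrightarrow> pderiv_at (Dep z J) L q = 0" "p \<in> \<U>"
  shows "var_deriv z L p = pderiv_at (Dep z (\<lambda>_. 0)) L p"
proof -
  have "total_deriv_multi J (pderiv_at (Dep z J) L) p = 0" if "J \<noteq> (\<lambda>_. 0)" for J
    by (rule total_deriv_multi_eq_0[OF assms(1) assms(2)]) (use that in auto)
  then have "var_deriv z L p
      = (\<Sum>J\<in>{\<lambda>_. 0}. (-1) ^ order_of J * total_deriv_multi J (pderiv_at (Dep z J) L) p)"
    unfolding var_deriv_def by (intro Sum_any.expand_superset) auto
  then show ?thesis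
    by (simp add: order_of_0 total_deriv_multi_0)
qed

text \<open>Makes the \<open>Sup\<close> in \<open>top_order\<close> an honest upper bound.\<close>

lemma finite_occurs:
  assumes "df L"
  shows "finite {J. occurs \<U> L z J}"
proof -
  obtain S where S: "finite S" "S \<subseteq> jet_coords Z" "depends_on \<U> S L"
    by (rule df_support[OF assms])
  have "Dep z ` {J. occurs \<U> L z J} \<subseteq> S"
    using depends_on_imp_pderiv_at_eq_0[OF open_domain S(3)] by (auto simp: occurs_def)
  then have "finite (Dep z ` {J. occurs \<U> L z J})"
    using S(1) finite_subset by blast
  then show ?thesis
    by (rule finite_imageD) (auto simp: inj_on_def)
qed

lemma pderiv_at_eq_0_above_top_order:
  assumes "df L" "q \<in> \<U>" "\<not> (\<forall>j. J j \<le> top_order \<U> L z j)"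
  shows "pderiv_at (Dep z J) L q = 0"
proof (rule ccontr)
  assume "pderiv_at (Dep z J) L q \<noteq> 0"
  then have J: "occurs \<U> L z J"
    using assms(2) by (auto simp: occurs_def)
  have "J j \<le> top_order \<U> L z j" for j
    unfolding top_order_def
  proof (rule le_cSup_finite)
    have "finite ((\<lambda>J. J j) ` {J. occurs \<U> L z J})"
      by (intro finite_imageI finite_occurs assms(1))
    then show "finite {J j | J. occurs \<U> L z J}"
      by (rule rev_finite_subset) auto
    show "J j \<in> {J j | J. occurs \<U> L z J}"
      using J by blast
  qed
  with assms(3) show False by blast
qed

lemma df_noether_vector:
  assumes "\<And>i. df (\<xi> i)" "\<And>z. z \<in> Z \<Longrightarrow> df (\<zeta> z)" "df L" "\<And>i. df (B i)"
  shows "df (noether_vector wt \<U> Z \<xi> \<zeta> L B i)"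
  unfolding noether_vector_def[abs_def]
  by (intro df_add df_uminus df_mult df_sum df_total_deriv_multi df_characteristic df_const
      df_pderiv_at assms)

lemma var_deriv_eq_sum:
  assumes "df L" "p \<in> \<U>"
  shows "var_deriv z L p = (\<Sum>J | \<forall>j. J j \<le> top_order \<U> L z j.
    (-1) ^ order_of J * total_deriv_multi J (pderiv_at (Dep z J) L) p)"
  unfolding var_deriv_def
proof (rule Sum_any.expand_superset[OF finite_multiindex_box])
  have "total_deriv_multi J (pderiv_at (Dep z J) L) p = 0" if "\<not> (\<forall>j. J j \<le> top_order \<U> L z j)" for J
    by (rule total_deriv_multi_eq_0[OF _ assms(2)])
       (rule pderiv_at_eq_0_above_top_order[OF assms(1) _ that])
  then show "{J. (-1) ^ order_of J * total_deriv_multi J (pderiv_at (Dep z J) L) p \<noteq> 0}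
      \<subseteq> {J. \<forall>j. J j \<le> top_order \<U> L z j}"
    by auto
qed

lemma prolong_eq_sum:
  assumes "df L" "p \<in> \<U>" "finite Z"
  shows "prolong \<xi> \<zeta> L p = (\<Sum>i\<in>UNIV. \<xi> i p * total_deriv i L p)
    + (\<Sum>z\<in>Z. \<Sum>J | \<forall>j. J j \<le> top_order \<U> L z j.
        total_deriv_multi J (characteristic \<xi> \<zeta> z) p * pderiv_at (Dep z J) L p)"
proof -
  let ?Box = "\<lambda>z. {J. \<forall>j. J j \<le> top_order \<U> L z j}"
  let ?g = "\<lambda>(z, J). total_deriv_multi J (characteristic \<xi> \<zeta> z) p * pderiv_at (Dep z J) L p"
  have "Sum_any ?g = sum ?g (Sigma Z ?Box)"
  proof (rule Sum_any.expand_superset)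
    show "finite (Sigma Z ?Box)"
      using assms(3) finite_multiindex_box by blast
    show "{zJ. ?g zJ \<noteq> 0} \<subseteq> Sigma Z ?Box"
    proof
      fix x assume x: "x \<in> {zJ. ?g zJ \<noteq> 0}"
      obtain z J where zJ: "x = (z, J)" by (cases x)
      have nz: "pderiv_at (Dep z J) L p \<noteq> 0" using x zJ by auto
      then have "z \<in> Z"
        using diff_fun_pderiv_at_eq_0[OF open_domain assms(1) _ assms(2), of "Dep z J"] by auto
      moreover have "J \<in> ?Box z"
        using pderiv_at_eq_0_above_top_order[OF assms(1,2), of J z] nz by blast
      ultimately show "x \<in> Sigma Z ?Box" by (simp add: zJ)
    qed
  qed
  also have "\<dots> = (\<Sum>z\<in>Z. \<Sum>J\<in>?Box z. ?g (z, J))"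
    by (subst sum.Sigma) (use assms(3) finite_multiindex_box in auto)
  finally show ?thesis
    unfolding prolong_def by simp
qed

text \<open>The part of the vector with derivatives of the characteristics contributes the
  evolutionary part of \<open>prolong \<xi> \<zeta> L\<close> up to the variational terms, and the
  product rule for \<open>\<xi>\<^sup>i L\<close> contributes the transport part and
  \<open>L * divergence \<xi>\<close>. The invariance criterion then cancels everything else against
  \<open>divergence B\<close>.\<close>

lemma divergence_noether_vector:
  assumes "\<And>i. df (\<xi> i)" "\<And>z. z \<in> Z \<Longrightarrow> df (\<zeta> z)" "df L" "\<And>i. df (B i)" "finite Z"
    and "invariance_criterion \<U> \<xi> \<zeta> L B" "p \<in> \<U>"
  shows "divergence (noether_vector noether_weight \<U> Z \<xi> \<zeta> L B) p
    = - (\<Sum>z\<in>Z. characteristic \<xi> \<zeta> z p * var_deriv z L p)"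
proof -
  note p = assms(7)
  let ?W = "characteristic \<xi> \<zeta>"
  have W: "df (?W z)" if "z \<in> Z" for z
    using that assms(1,2) by (intro df_characteristic)
  define N where "N z i q = (\<Sum>K\<in>{K. (\<forall>j. K j \<le> top_order \<U> L z j) \<and> K i < top_order \<U> L z i}.
       total_deriv_multi K (?W z) q * (\<Sum>M\<in>{M. \<forall>j. M j \<le> top_order \<U> L z j - K j}.
         noether_weight i K M * ((-1) ^ order_of M
           * total_deriv_multi M (pderiv_at (Dep z (plus_inc i K M)) L) q)))" for z i q
  have N: "df (N z i)" if "z \<in> Z" for z i
    unfolding N_def[abs_def]
    by (intro df_mult df_sum df_total_deriv_multi W that df_const df_pderiv_at assms(3))
  have "divergence (noether_vector noether_weight \<U> Z \<xi> \<zeta> L B) p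
      = (\<Sum>i\<in>UNIV. total_deriv i (\<lambda>q. - B i q + \<xi> i q * L q + (\<Sum>z\<in>Z. N z i q)) p)"
    unfolding divergence_def noether_vector_def[abs_def] N_def ..
  also have "\<dots> = (\<Sum>i\<in>UNIV. - total_deriv i (B i) p
      + (total_deriv i (\<xi> i) p * L p + \<xi> i p * total_deriv i L p) + (\<Sum>z\<in>Z. total_deriv i (N z i) p))"
    by (simp add: total_deriv_add total_deriv_diff total_deriv_mult total_deriv_sum df_add df_diff
        df_mult df_sum N assms p)
  also have "\<dots> = - divergence B p + L p * divergence \<xi> p + (\<Sum>i\<in>UNIV. \<xi> i p * total_deriv i L p)
      + (\<Sum>z\<in>Z. \<Sum>i\<in>UNIV. total_deriv i (N z i) p)"
    unfolding divergence_def sum.swap[of "\<lambda>z i. total_deriv i (N z i) p" UNIV Z]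
    by (simp add: sum.distrib sum_negf sum_subtractf sum_distrib_left mult.commute)
  also have "(\<Sum>z\<in>Z. \<Sum>i\<in>UNIV. total_deriv i (N z i) p)
      = (\<Sum>z\<in>Z. (\<Sum>J | \<forall>j. J j \<le> top_order \<U> L z j. total_deriv_multi J (?W z) p * pderiv_at (Dep z J) L p)
        - ?W z p * var_deriv z L p)"
  proof (rule sum.cong[OF refl])
    fix z assume z: "z \<in> Z"
    show "(\<Sum>i\<in>UNIV. total_deriv i (N z i) p)
        = (\<Sum>J | \<forall>j. J j \<le> top_order \<U> L z j. total_deriv_multi J (?W z) p * pderiv_at (Dep z J) L p)
          - ?W z p * var_deriv z L p"
      unfolding N_def[abs_def] var_deriv_eq_sum[OF assms(3) p]
      by (rule noether_identity[OF W[OF z] df_pderiv_at[OF assms(3)] p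
            pderiv_at_eq_0_above_top_order[OF assms(3)]])
  qed
  finally have "divergence (noether_vector noether_weight \<U> Z \<xi> \<zeta> L B) p
      = - divergence B p + L p * divergence \<xi> p + prolong \<xi> \<zeta> L p
        - (\<Sum>z\<in>Z. ?W z p * var_deriv z L p)"
    unfolding prolong_eq_sum[OF assms(3) p assms(5)] by (simp add: sum_subtractf)
  moreover have "prolong \<xi> \<zeta> L p + L p * divergence \<xi> p = divergence B p"
    using assms(6) p unfolding invariance_criterion_def by blast
  ultimately show ?thesis by simp
qed

end

section \<open>Lagrangians without mixed derivatives\<close>

lemma multinom_single:
  assumes "\<And>j. j \<noteq> i \<Longrightarrow> J j = 0"
  shows "multinom J = 1"
proof -
  have "order_of J = (\<Sum>j\<in>UNIV. if j = i then J i else 0)"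
    unfolding order_of_def by (rule sum.cong) (use assms in auto)
  moreover have "(\<Prod>j\<in>UNIV. fact (J j)) = (\<Prod>j\<in>UNIV. if j = i then fact (J i) else (1 :: real))"
    by (rule prod.cong) (use assms in auto)
  ultimately show ?thesis
    unfolding multinom_def by simp
qed

text \<open>Entry \<open>i\<close> of \<open>plus_inc i K M\<close> is positive, which forces
  \<open>i = i'\<close>; then \<open>K\<close> and \<open>M\<close> are also concentrated in
  direction \<open>i\<close>, and all three multinomial coefficients are 1.\<close>

lemma noether_weight_eq_1:
  assumes "\<And>j. j \<noteq> i' \<Longrightarrow> plus_inc i K M j = 0"
  shows "noether_weight i K M = 1"
proof -
  have i: "i = i'"
    using assms[of i] by (cases "i = i'") auto
  have KM: "K j = 0 \<and> M j = 0" if "j \<noteq> i" for j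
    using assms[of j] that i by simp
  have "multinom (plus_inc i K M) = 1"
    by (rule multinom_single[OF assms])
  moreover have "multinom K = 1"
    by (rule multinom_single) (rule KM[THEN conjunct1])
  moreover have "multinom M = 1"
    by (rule multinom_single) (rule KM[THEN conjunct2])
  ultimately show ?thesis
    unfolding noether_weight_def by (simp only: mult_1 div_by_1)
qed

context jet_domain
begin

text \<open>The vectors agree summand by summand: a derivative that occurs is unmixed and has weight
  1, and one that does not occur has a partial derivative vanishing on all of \<open>\<U>\<close>,
  hence vanishing total derivatives.\<close>

lemma noether_vector_unweighted:
  assumes "no_mixed_derivatives \<U> Z L" "p \<in> \<U>"
  shows "noether_vector noether_weight \<U> Z \<xi> \<zeta> L B i p = noether_vector (\<lambda>_ _ _. 1) \<U> Z \<xi> \<zeta> L B i p"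
proof -
  let ?D = "\<lambda>z K M. total_deriv_multi M (pderiv_at (Dep z (plus_inc i K M)) L) p"
  have summand: "noether_weight i K M * ((-1) ^ order_of M * ?D z K M) = 1 * ((-1) ^ order_of M * ?D z K M)"
    if "z \<in> Z" for z K M
  proof (cases "occurs \<U> L z (plus_inc i K M)")
    case True
    have "\<exists>i'. \<forall>j. j \<noteq> i' \<longrightarrow> plus_inc i K M j = 0"
      by (rule assms(1)[unfolded no_mixed_derivatives_def, rule_format, OF that True])
    then obtain i' where "\<forall>j. j \<noteq> i' \<longrightarrow> plus_inc i K M j = 0"
      by (rule exE)
    then have "noether_weight i K M = 1"
      by (intro noether_weight_eq_1[of i']) (drule spec, erule mp)
    then show ?thesis
      by (simp only:)
  next
    case False
    have "pderiv_at (Dep z (plus_inc i K M)) L q = 0" if "q \<in> \<U>" for q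
      using False that unfolding occurs_def by blast
    then have "?D z K M = 0"
      by (rule total_deriv_multi_eq_0[OF _ assms(2)])
    then show ?thesis
      by (simp only: mult_zero_right)
  qed
  have inner: "total_deriv_multi K (characteristic \<xi> \<zeta> z) p
        * (\<Sum>M\<in>A. noether_weight i K M * ((-1) ^ order_of M * ?D z K M))
      = total_deriv_multi K (characteristic \<xi> \<zeta> z) p * (\<Sum>M\<in>A. 1 * ((-1) ^ order_of M * ?D z K M))"
    if "z \<in> Z" for z K A
    by (simp only: summand[OF that])
  show ?thesis
    unfolding noether_vector_def
    by (rule arg_cong[where f = "(+) _"], rule sum.cong[OF refl], rule sum.cong[OF refl], rule inner)
qed

end

section \<open>Lagrangians of systems with adjoint equations\<close>

locale admitted_operator =
  fixes \<U> :: "'n::{finite,linorder} jet set" and m mt r :: nat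
    and F :: "nat \<Rightarrow> 'n dfun" and lam :: "nat \<Rightarrow> nat \<Rightarrow> 'n list \<Rightarrow> 'n dfun"
    and \<xi> :: "'n \<Rightarrow> 'n dfun" and \<eta> \<eta>t :: "nat \<Rightarrow> 'n dfun"
  assumes open_jet_domain: "open \<U>"
    and diff_fun_F: "\<And>\<alpha>. \<alpha> \<in> {1..m} \<Longrightarrow> diff_fun \<U> (jet_coords (base_vars m mt)) (F \<alpha>)"
    and lie_backlund: "lie_backlund_operator \<U> m mt F r lam \<xi> \<eta> \<eta>t"
begin

sublocale jet_domain \<U> "all_vars m mt"
  by unfold_locales (rule open_jet_domain)

abbreviation L :: "'n dfun" where
  "L \<equiv> lagrangian m mt F"

definition w :: "nat \<Rightarrow> 'n dfun" where
  "w \<alpha> p = p (Dep (Var_v \<alpha>) (\<lambda>_. 0)) + (\<Sum>\<beta>=1..mt. p (Dep (Var_vt \<beta>) (\<lambda>_. 0)))"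

text \<open>The formal adjoint of \<open>diff_op r (lam \<mu> \<beta>)\<close>, applied to
  \<open>w \<mu>\<close>.\<close>

definition adj_op :: "nat \<Rightarrow> nat \<Rightarrow> 'n dfun" where
  "adj_op \<mu> \<beta> p = w \<mu> p * lam \<mu> \<beta> [] p
     + (\<Sum>k=1..r. (-1) ^ k * (\<Sum>I\<in>{I. length I = k}. foldr total_deriv I (\<lambda>q. w \<mu> q * lam \<mu> \<beta> I q) p))"

lemma base_vars_subset: "base_vars m mt \<subseteq> all_vars m mt"
  unfolding all_vars_def by blast

lemma finite_all_vars: "finite (all_vars m mt)"
  unfolding all_vars_def base_vars_def by simp

lemma df_base: "diff_fun \<U> (jet_coords (base_vars m mt)) f \<Longrightarrow> df f"
  by (rule diff_fun_mono[OF _ jet_coords_mono[OF base_vars_subset]])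

lemma df_F: "\<alpha> \<in> {1..m} \<Longrightarrow> df (F \<alpha>)"
  by (rule df_base[OF diff_fun_F])

lemma df_operator:
  shows "df (\<xi> i)" and "b \<in> {1..m} \<Longrightarrow> df (\<eta> b)" and "b \<in> {1..mt} \<Longrightarrow> df (\<eta>t b)"
    and "\<nu> \<in> {1..m} \<Longrightarrow> \<mu> \<in> {1..m} \<Longrightarrow> length I \<le> r \<Longrightarrow> df (lam \<nu> \<mu> I)"
  using lie_backlund unfolding lie_backlund_operator_def admitted_def
  by (simp_all add: df_base)

lemma admitted_F:
  "\<nu> \<in> {1..m} \<Longrightarrow> p \<in> \<U> \<Longrightarrow>
   prolong \<xi> (op_coeffs \<eta> \<eta>t (\<lambda>_ _. 0) (\<lambda>_ _. 0)) (F \<nu>) p = (\<Sum>\<mu>=1..m. diff_op r (lam \<nu> \<mu>) (F \<mu>) p)"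
  using lie_backlund unfolding lie_backlund_operator_def admitted_def by blast

lemma df_v: "\<alpha> \<in> {1..m} \<Longrightarrow> df (\<lambda>p. p (Dep (Var_v \<alpha>) (\<lambda>_. 0)))"
  by (rule df_coord) (auto simp: all_vars_def)

lemma df_vt: "\<beta> \<in> {1..mt} \<Longrightarrow> df (\<lambda>p. p (Dep (Var_vt \<beta>) (\<lambda>_. 0)))"
  by (rule df_coord) (auto simp: all_vars_def)

lemma df_w: "\<alpha> \<in> {1..m} \<Longrightarrow> df (w \<alpha>)"
  unfolding w_def[abs_def] by (intro df_add df_v df_sum df_vt)

lemma vector_field_w:
  assumes "\<alpha> \<in> {1..m}" "p \<in> \<U>"
  shows "vector_field b (w \<alpha>) p
    = b (Dep (Var_v \<alpha>) (\<lambda>_. 0)) p + (\<Sum>\<beta>=1..mt. b (Dep (Var_vt \<beta>) (\<lambda>_. 0)) p)"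
proof -
  have "vector_field b (w \<alpha>) p = vector_field b (\<lambda>q. q (Dep (Var_v \<alpha>) (\<lambda>_. 0))) p
      + vector_field b (\<lambda>q. \<Sum>\<beta>=1..mt. q (Dep (Var_vt \<beta>) (\<lambda>_. 0))) p"
    unfolding w_def[abs_def] by (intro vector_field_add df_v df_sum df_vt assms)
  also have "vector_field b (\<lambda>q. \<Sum>\<beta>=1..mt. q (Dep (Var_vt \<beta>) (\<lambda>_. 0))) p
      = (\<Sum>\<beta>=1..mt. vector_field b (\<lambda>q. q (Dep (Var_vt \<beta>) (\<lambda>_. 0))) p)"
    by (intro vector_field_sum df_vt assms)
  finally show ?thesis
    unfolding vector_field_coord .
qed

lemma lagrangian_eq: "L = (\<lambda>p. \<Sum>\<beta>=1..m. w \<beta> p * F \<beta> p)"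
  by (simp add: fun_eq_iff lagrangian_def w_def distrib_right sum.distrib sum_distrib_left)

lemma df_L: "df L"
  unfolding lagrangian_eq by (intro df_sum df_mult df_w df_F)

lemma df_divergence: "df (divergence \<xi>)"
  unfolding divergence_def[abs_def] by (intro df_sum df_total_deriv df_operator)

lemma df_adj_op:
  assumes "\<mu> \<in> {1..m}" "\<beta> \<in> {1..m}"
  shows "df (adj_op \<mu> \<beta>)"
  unfolding adj_op_def[abs_def]
  by (intro df_add df_mult df_sum df_w df_const df_total_derivs df_operator assms) auto

lemma adjoint_extension_iff:
  "adjoint_extension \<U> m mt r lam \<xi> \<eta>s \<eta>ts \<longleftrightarrow>
     (\<forall>\<beta>\<in>{1..m}. df (\<eta>s \<beta>)) \<and> (\<forall>\<beta>\<in>{1..mt}. df (\<eta>ts \<beta>)) \<and>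
     (\<forall>\<beta>\<in>{1..m}. \<forall>p\<in>\<U>. \<eta>s \<beta> p + (\<Sum>b=1..mt. \<eta>ts b p)
        = - (w \<beta> p * divergence \<xi> p + (\<Sum>\<mu>=1..m. adj_op \<mu> \<beta> p)))"
  unfolding adjoint_extension_def Let_def adj_op_def w_def ..

lemma ex_adjoint_extension: "\<exists>\<eta>s \<eta>ts. adjoint_extension \<U> m mt r lam \<xi> \<eta>s \<eta>ts"
proof (intro exI)
  \<comment> \<open>The condition prescribes only a sum of coefficients, so the coefficients for
    \<open>vt\<close> may be 0 and the one for \<open>v\<close> carries the whole right-hand
    side.\<close>
  let ?\<eta>s = "\<lambda>\<beta> p. - (w \<beta> p * divergence \<xi> p + (\<Sum>\<mu>=1..m. adj_op \<mu> \<beta> p))"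
  have "df (?\<eta>s \<beta>)" if "\<beta> \<in> {1..m}" for \<beta>
    by (intro df_uminus df_add df_mult df_sum df_w df_divergence df_adj_op that)
  then show "adjoint_extension \<U> m mt r lam \<xi> ?\<eta>s (\<lambda>_ _. 0)"
    unfolding adjoint_extension_iff by (simp add: df_const)
qed

text \<open>Outside the base variables the derivative falls on the factors \<open>w \<alpha>\<close>
  only; the indicators treat both kinds of adjoint variables at once.\<close>

lemma pderiv_at_lagrangian:
  assumes "z \<notin> base_vars m mt" "p \<in> \<U>"
  shows "pderiv_at (Dep z J) L p = (\<Sum>\<alpha>=1..m. ((if z = Var_v \<alpha> \<and> J = (\<lambda>_. 0) then 1 else 0)
    + (\<Sum>\<beta>=1..mt. if z = Var_vt \<beta> \<and> J = (\<lambda>_. 0) then 1 else 0)) * F \<alpha> p)"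
proof -
  let ?D = "vector_field (\<lambda>d _. if d = Dep z J then 1 else 0)"
  have F: "?D (F \<alpha>) p = 0" if "\<alpha> \<in> {1..m}" for \<alpha>
    using diff_fun_pderiv_at_eq_0[OF open_domain diff_fun_F[OF that] _ assms(2), of "Dep z J"] assms(1)
    by (simp add: pderiv_at_eq_vector_field)
  have w: "?D (w \<alpha>) p = (if z = Var_v \<alpha> \<and> J = (\<lambda>_. 0) then 1 else 0)
      + (\<Sum>\<beta>=1..mt. if z = Var_vt \<beta> \<and> J = (\<lambda>_. 0) then 1 else 0)" if "\<alpha> \<in> {1..m}" for \<alpha>
    unfolding vector_field_w[OF that assms(2)] by (auto intro!: sum.cong)
  have "pderiv_at (Dep z J) L p = (\<Sum>\<alpha>=1..m. ?D (\<lambda>q. w \<alpha> q * F \<alpha> q) p)"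
    unfolding pderiv_at_eq_vector_field lagrangian_eq
    by (rule vector_field_sum) (auto intro!: df_mult df_w df_F assms(2))
  also have "\<dots> = (\<Sum>\<alpha>=1..m. ?D (w \<alpha>) p * F \<alpha> p)"
    by (rule sum.cong) (auto simp: vector_field_mult df_w df_F assms(2) F)
  finally show ?thesis
    using w by simp
qed

lemma var_deriv_v:
  assumes "\<beta> \<in> {1..m}" "p \<in> \<U>"
  shows "var_deriv (Var_v \<beta>) L p = F \<beta> p"
proof -
  have base: "Var_v \<beta> \<notin> base_vars m mt"
    by (auto simp: base_vars_def)
  have *: "pderiv_at (Dep (Var_v \<beta>) J) L q = (if J = (\<lambda>_. 0) then F \<beta> q else 0)" if "q \<in> \<U>" for J q
    unfolding pderiv_at_lagrangian[OF base that]
    using assms(1) by (auto simp: if_distrib[of "\<lambda>x. x * _"] sum.delta cong: if_cong)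
  show ?thesis
    using var_deriv_order_0[of "Var_v \<beta>" L p] assms(2) by (simp add: *)
qed

lemma var_deriv_vt:
  assumes "\<beta> \<in> {1..mt}" "p \<in> \<U>"
  shows "var_deriv (Var_vt \<beta>) L p = (\<Sum>\<alpha>=1..m. F \<alpha> p)"
proof -
  have base: "Var_vt \<beta> \<notin> base_vars m mt"
    by (auto simp: base_vars_def)
  have *: "pderiv_at (Dep (Var_vt \<beta>) J) L q = (if J = (\<lambda>_. 0) then \<Sum>\<alpha>=1..m. F \<alpha> q else 0)"
    if "q \<in> \<U>" for J q
    unfolding pderiv_at_lagrangian[OF base that] using assms(1) by auto
  show ?thesis
    using var_deriv_order_0[of "Var_vt \<beta>" L p] assms(2) by (simp add: *)
qed

lemma var_deriv_solution:
  assumes "solution \<U> m mt F \<Omega> \<phi>" "x \<in> \<Omega>" "z \<in> all_vars m mt"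
  shows "var_deriv z L (jet_of \<phi> x) = 0"
proof -
  have sol: "jet_of \<phi> x \<in> \<U>" "\<And>\<alpha>. \<alpha> \<in> {1..m} \<Longrightarrow> F \<alpha> (jet_of \<phi> x) = 0"
    "\<And>\<alpha>. \<alpha> \<in> {1..m} \<Longrightarrow> var_deriv (Var_u \<alpha>) L (jet_of \<phi> x) = 0"
    "\<And>\<alpha>. \<alpha> \<in> {1..mt} \<Longrightarrow> var_deriv (Var_ut \<alpha>) L (jet_of \<phi> x) = 0"
    using assms(1,2) unfolding solution_def adj_def adj_t_def by blast+
  show ?thesis
    using assms(3) sol unfolding all_vars_def base_vars_def
    by (auto simp: var_deriv_v var_deriv_vt)
qed

text \<open>Integration by parts for each index list, with
  \<open>w \<nu> * lam \<nu> \<mu> I\<close> as the factor that receives the derivatives. The terms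
  of order 0 cancel exactly.\<close>

lemma is_divergence_diff_op_adj_op:
  assumes "\<nu> \<in> {1..m}" "\<mu> \<in> {1..m}"
  shows "is_divergence (\<lambda>p. w \<nu> p * diff_op r (lam \<nu> \<mu>) (F \<mu>) p - F \<mu> p * adj_op \<nu> \<mu> p)"
proof -
  have "is_divergence (\<lambda>p. \<Sum>k=1..r. \<Sum>I\<in>{I. length I = k}. (w \<nu> p * lam \<nu> \<mu> I p) * foldr total_deriv I (F \<mu>) p
     - (-1) ^ length I * F \<mu> p * foldr total_deriv I (\<lambda>q. w \<nu> q * lam \<nu> \<mu> I q) p)"
    using assms by (intro is_divergence_sum is_divergence_adjoint df_F df_mult df_w df_operator) auto
  then show ?thesis
    by (rule is_divergence_cong)
       (simp add: diff_op_def adj_op_def sum_subtractf sum_distrib_left algebra_simps)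
qed

end

section \<open>Invariance of the Lagrangian under the extended operator, and conservation\<close>

locale extended_operator = admitted_operator +
  fixes \<eta>s \<eta>ts :: "nat \<Rightarrow> 'a dfun"
  assumes extension: "adjoint_extension \<U> m mt r lam \<xi> \<eta>s \<eta>ts"
begin

abbreviation \<zeta> :: "dep \<Rightarrow> 'a dfun" where
  "\<zeta> \<equiv> op_coeffs \<eta> \<eta>t \<eta>s \<eta>ts"

lemma df_\<zeta>: "z \<in> all_vars m mt \<Longrightarrow> df (\<zeta> z)"
  using extension df_operator(2,3) unfolding adjoint_extension_iff all_vars_def base_vars_def by auto

text \<open>Since \<open>w \<beta>\<close> has order 0, its prolongation is just the sum of
  coefficients that the extension condition prescribes; the separate coefficients never matter
  here.\<close>

lemma prolong_w:
  assumes "\<beta> \<in> {1..m}" "p \<in> \<U>"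
  shows "prolong \<xi> \<zeta> (w \<beta>) p = - (w \<beta> p * divergence \<xi> p + (\<Sum>\<mu>=1..m. adj_op \<mu> \<beta> p))"
proof -
  let ?D = "vector_field (prolong_coeff \<xi> \<zeta>)"
  have "prolong \<xi> \<zeta> (w \<beta>) p = ?D (w \<beta>) p"
    by (rule prolong_eq_vector_field[OF df_w[OF assms(1)] assms(2)])
  also have "\<dots> = \<eta>s \<beta> p + (\<Sum>b=1..mt. \<eta>ts b p)"
    by (simp only: vector_field_w[OF assms] prolong_coeff_order_0 op_coeffs.simps)
  also have "\<dots> = - (w \<beta> p * divergence \<xi> p + (\<Sum>\<mu>=1..m. adj_op \<mu> \<beta> p))"
    using extension assms unfolding adjoint_extension_iff by blast
  finally show ?thesis .
qed

text \<open>\<open>F \<nu>\<close> involves base variables only, and there \<open>Y\<close> has the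
  coefficients of \<open>X\<close>; so the admittance identity passes from \<open>X\<close> to
  \<open>Y\<close>.\<close>

lemma prolong_F:
  assumes "\<nu> \<in> {1..m}" "p \<in> \<U>"
  shows "prolong \<xi> \<zeta> (F \<nu>) p = (\<Sum>\<mu>=1..m. diff_op r (lam \<nu> \<mu>) (F \<mu>) p)"
proof -
  let ?\<zeta>0 = "op_coeffs \<eta> \<eta>t (\<lambda>_ _. 0) (\<lambda>_ _. 0)"
  have "total_deriv_multi J (characteristic \<xi> \<zeta> z) p * pderiv_at (Dep z J) (F \<nu>) p
      = total_deriv_multi J (characteristic \<xi> ?\<zeta>0 z) p * pderiv_at (Dep z J) (F \<nu>) p" for z J
  proof (cases "z \<in> base_vars m mt")
    case True
    then have "\<zeta> z = ?\<zeta>0 z" unfolding base_vars_def by auto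
    then have "characteristic \<xi> \<zeta> z = characteristic \<xi> ?\<zeta>0 z"
      by (simp add: characteristic_def fun_eq_iff)
    then show ?thesis by simp
  next
    case False
    then show ?thesis
      using diff_fun_pderiv_at_eq_0[OF open_domain diff_fun_F[OF assms(1)] _ assms(2), of "Dep z J"]
      by simp
  qed
  then have "prolong \<xi> \<zeta> (F \<nu>) p = prolong \<xi> ?\<zeta>0 (F \<nu>) p"
    unfolding prolong_def by (simp only:)
  then show ?thesis
    using admitted_F[OF assms] by simp
qed

text \<open>The term \<open>- w * divergence \<xi>\<close> in the extension condition is there to
  cancel \<open>L * divergence \<xi>\<close>.\<close>

lemma prolong_L:
  assumes "p \<in> \<U>"
  shows "prolong \<xi> \<zeta> L p + L p * divergence \<xi> p
    = (\<Sum>\<nu>=1..m. \<Sum>\<mu>=1..m. w \<nu> p * diff_op r (lam \<nu> \<mu>) (F \<mu>) p - F \<mu> p * adj_op \<nu> \<mu> p)"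
proof -
  let ?D = "vector_field (prolong_coeff \<xi> \<zeta>)"
  have "prolong \<xi> \<zeta> L p = ?D L p"
    by (rule prolong_eq_vector_field[OF df_L assms])
  also have "\<dots> = (\<Sum>\<nu>=1..m. ?D (\<lambda>q. w \<nu> q * F \<nu> q) p)"
    unfolding lagrangian_eq
    by (rule vector_field_sum) (auto intro!: df_mult df_w df_F assms)
  also have "\<dots> = (\<Sum>\<nu>=1..m. prolong \<xi> \<zeta> (w \<nu>) p * F \<nu> p + w \<nu> p * prolong \<xi> \<zeta> (F \<nu>) p)"
    by (rule sum.cong)
       (auto simp: vector_field_mult df_w df_F assms prolong_eq_vector_field)
  also have "\<dots> = (\<Sum>\<nu>=1..m. - (w \<nu> p * divergence \<xi> p + (\<Sum>\<mu>=1..m. adj_op \<mu> \<nu> p)) * F \<nu> p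
      + w \<nu> p * (\<Sum>\<mu>=1..m. diff_op r (lam \<nu> \<mu>) (F \<mu>) p))"
    by (rule sum.cong) (simp_all add: prolong_w prolong_F assms)
  finally have "prolong \<xi> \<zeta> L p + L p * divergence \<xi> p
      = (\<Sum>\<nu>=1..m. \<Sum>\<mu>=1..m. w \<nu> p * diff_op r (lam \<nu> \<mu>) (F \<mu>) p)
        - (\<Sum>\<nu>=1..m. \<Sum>\<mu>=1..m. F \<nu> p * adj_op \<mu> \<nu> p)"
    unfolding lagrangian_eq
    by (simp add: sum_distrib_left sum_distrib_right sum.distrib sum_subtractf algebra_simps)
  \<comment> \<open>The adjoint terms arise with transposed indices; exchanging the sums pairs each
    operator with its own adjoint.\<close>
  also have "(\<Sum>\<nu>=1..m. \<Sum>\<mu>=1..m. F \<nu> p * adj_op \<mu> \<nu> p)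
      = (\<Sum>\<nu>=1..m. \<Sum>\<mu>=1..m. F \<mu> p * adj_op \<nu> \<mu> p)"
    by (rule sum.swap)
  finally show ?thesis
    by (simp add: sum_subtractf)
qed

lemma ex_invariance_criterion:
  "\<exists>B. (\<forall>i. df (B i)) \<and> invariance_criterion \<U> \<xi> \<zeta> L B"
proof -
  have "is_divergence (\<lambda>p. \<Sum>\<nu>=1..m. \<Sum>\<mu>=1..m. w \<nu> p * diff_op r (lam \<nu> \<mu>) (F \<mu>) p - F \<mu> p * adj_op \<nu> \<mu> p)"
    by (intro is_divergence_sum is_divergence_diff_op_adj_op)
  then have "is_divergence (\<lambda>p. prolong \<xi> \<zeta> L p + L p * divergence \<xi> p)"
    by (rule is_divergence_cong) (simp add: prolong_L)
  then show ?thesis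
    unfolding is_divergence_def invariance_criterion_def .
qed

lemma conserved_vector_noether:
  assumes "\<And>i. df (B i)" "invariance_criterion \<U> \<xi> \<zeta> L B"
  shows "conserved_vector \<U> m mt F (noether_vector noether_weight \<U> (all_vars m mt) \<xi> \<zeta> L B)"
  unfolding conserved_vector_def
proof (intro conjI allI impI ballI)
  show "df (noether_vector noether_weight \<U> (all_vars m mt) \<xi> \<zeta> L B i)" for i
    by (rule df_noether_vector[OF df_operator(1) df_\<zeta> df_L assms(1)])
  fix \<Omega> \<phi> x assume sol: "solution \<U> m mt F \<Omega> \<phi>" "x \<in> \<Omega>"
  then have "jet_of \<phi> x \<in> \<U>" unfolding solution_def by blast
  then show "divergence (noether_vector noether_weight \<U> (all_vars m mt) \<xi> \<zeta> L B) (jet_of \<phi> x) = 0"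
    using divergence_noether_vector[OF df_operator(1) df_\<zeta> df_L assms(1) finite_all_vars assms(2)]
    by (simp add: var_deriv_solution[OF sol])
qed

lemma conserved_vector_noether_unweighted:
  assumes "\<And>i. df (B i)" "invariance_criterion \<U> \<xi> \<zeta> L B"
    and "no_mixed_derivatives \<U> (all_vars m mt) L"
  shows "conserved_vector \<U> m mt F (noether_vector (\<lambda>_ _ _. 1) \<U> (all_vars m mt) \<xi> \<zeta> L B)"
  unfolding conserved_vector_def
proof (intro conjI allI impI ballI)
  show "df (noether_vector (\<lambda>_ _ _. 1) \<U> (all_vars m mt) \<xi> \<zeta> L B i)" for i
    by (rule df_noether_vector[OF df_operator(1) df_\<zeta> df_L assms(1)])
  fix \<Omega> \<phi> x assume sol: "solution \<U> m mt F \<Omega> \<phi>" "x \<in> \<Omega>"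
  then have x: "jet_of \<phi> x \<in> \<U>" unfolding solution_def by blast
  have "divergence (noether_vector (\<lambda>_ _ _. 1) \<U> (all_vars m mt) \<xi> \<zeta> L B) (jet_of \<phi> x)
      = divergence (noether_vector noether_weight \<U> (all_vars m mt) \<xi> \<zeta> L B) (jet_of \<phi> x)"
    unfolding divergence_def
    \<comment> \<open>The components agree on all of \<open>\<U>\<close>, so they may be
      differentiated; agreement on solutions alone would not suffice for this rule.\<close>
    by (intro sum.cong refl total_deriv_cong[OF x] noether_vector_unweighted[symmetric] assms(3))
  then show "divergence (noether_vector (\<lambda>_ _ _. 1) \<U> (all_vars m mt) \<xi> \<zeta> L B) (jet_of \<phi> x) = 0"
    using conserved_vector_noether[OF assms(1,2)] sol unfolding conserved_vector_def by simp
qed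

end

section \<open>Reduction of point symmetries to Lie-Backlund operators, and the conservation
  theorem\<close>

lemma admitted_mono:
  assumes "admitted Cs \<U> m mt F r lam \<xi> \<eta> \<eta>t" "Cs \<subseteq> Cs'"
  shows "admitted Cs' \<U> m mt F r lam \<xi> \<eta> \<eta>t"
proof -
  have mono: "diff_fun \<U> Cs f \<Longrightarrow> diff_fun \<U> Cs' f" for f
    by (rule diff_fun_mono[OF _ assms(2)])
  show ?thesis
    using assms(1) unfolding admitted_def
    by (elim conjE) (intro conjI; (assumption | intro allI ballI mono; erule spec bspec; assumption))
qed

text \<open>Functions of the point coordinates are differential functions, and a multiplier
  \<open>\<lambda>\<^sup>0\<close> is a differential operator of order \<open>r = 0\<close>.\<close>

lemma point_symmetry_generator_imp_lie_backlund:
  "point_symmetry_generator \<U> m mt F r lam \<xi> \<eta> \<eta>t \<Longrightarrow> lie_backlund_operator \<U> m mt F r lam \<xi> \<eta> \<eta>t"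
  unfolding point_symmetry_generator_def lie_backlund_operator_def
  by (elim conjE) (rule admitted_mono[OF _ point_coords_subset])

theorem theorem3p4:
  fixes \<U> :: "'n::{finite,linorder} jet set" and m mt r :: nat
    and F :: "nat \<Rightarrow> 'n dfun"
    and lam :: "nat \<Rightarrow> nat \<Rightarrow> 'n list \<Rightarrow> 'n dfun"
    and \<xi> :: "'n \<Rightarrow> 'n dfun" and \<eta> \<eta>t :: "nat \<Rightarrow> 'n dfun"
  assumes "open \<U>"
    and "\<forall>\<alpha>\<in>{1..m}. diff_fun \<U> (jet_coords (base_vars m mt)) (F \<alpha>)"
    and "point_symmetry_generator \<U> m mt F r lam \<xi> \<eta> \<eta>t
         \<or> lie_backlund_operator \<U> m mt F r lam \<xi> \<eta> \<eta>t"
  shows "(\<exists>\<eta>s \<eta>ts. adjoint_extension \<U> m mt r lam \<xi> \<eta>s \<eta>ts) \<and>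
    (\<forall>\<eta>s \<eta>ts. adjoint_extension \<U> m mt r lam \<xi> \<eta>s \<eta>ts \<longrightarrow>
      (let L = lagrangian m mt F; \<zeta> = op_coeffs \<eta> \<eta>t \<eta>s \<eta>ts; Z = all_vars m mt in
       (\<exists>B. (\<forall>i. diff_fun \<U> (jet_coords Z) (B i)) \<and> invariance_criterion \<U> \<xi> \<zeta> L B) \<and>
       (\<forall>B. (\<forall>i. diff_fun \<U> (jet_coords Z) (B i)) \<and> invariance_criterion \<U> \<xi> \<zeta> L B \<longrightarrow>
          conserved_vector \<U> m mt F (noether_vector noether_weight \<U> Z \<xi> \<zeta> L B) \<and>
          (no_mixed_derivatives \<U> Z L \<longrightarrow>
             conserved_vector \<U> m mt F (noether_vector (\<lambda>_ _ _. 1) \<U> Z \<xi> \<zeta> L B)))))"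
proof -
  have "lie_backlund_operator \<U> m mt F r lam \<xi> \<eta> \<eta>t"
    using assms(3)
  proof
    assume "point_symmetry_generator \<U> m mt F r lam \<xi> \<eta> \<eta>t"
    then show ?thesis by (rule point_symmetry_generator_imp_lie_backlund)
  qed
  then interpret admitted_operator \<U> m mt r F lam \<xi> \<eta> \<eta>t
    by (intro admitted_operator.intro assms(1) assms(2)[rule_format])
  show ?thesis
    unfolding Let_def
  proof (intro conjI allI impI; (elim conjE)?)
    show "\<exists>\<eta>s \<eta>ts. adjoint_extension \<U> m mt r lam \<xi> \<eta>s \<eta>ts"
      by (rule ex_adjoint_extension)
  next
    fix \<eta>s \<eta>ts assume "adjoint_extension \<U> m mt r lam \<xi> \<eta>s \<eta>ts"
    then interpret extended_operator \<U> m mt r F lam \<xi> \<eta> \<eta>t \<eta>s \<eta>ts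
      by unfold_locales
    show "\<exists>B. (\<forall>i. df (B i)) \<and> invariance_criterion \<U> \<xi> \<zeta> L B"
      by (rule ex_invariance_criterion)
    fix B assume B: "\<forall>i. df (B i)" "invariance_criterion \<U> \<xi> \<zeta> L B"
    show "conserved_vector \<U> m mt F (noether_vector noether_weight \<U> (all_vars m mt) \<xi> \<zeta> L B)"
      by (rule conserved_vector_noether[OF B(1)[rule_format] B(2)])
    assume "no_mixed_derivatives \<U> (all_vars m mt) L"
    then show "conserved_vector \<U> m mt F (noether_vector (\<lambda>_ _ _. 1) \<U> (all_vars m mt) \<xi> \<zeta> L B)"
      by (rule conserved_vector_noether_unweighted[OF B(1)[rule_format] B(2)])
  qed
qed

end
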